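(* Consider the block-issuance model described in the context, with $k\ge2$, and let $\alpha$, $K$ (and $\ell_0$) be constants chosen as in the context; put $V_n:=X_n^{(o)}+\alpha L_n$. Then there exist constants $\eta>0$ and $\rho\in(0,1)$ such that for all integers $m,n\ge0$ and all real $M$, \[ \mathbb E\bigl[e^{\eta V_{m+n}}\,\big|\,\mathcal F_m\bigr]\le\rho^n e^{\eta V_m}+\frac{1-\rho^n}{1-\rho}\,e^{\eta(1+\alpha)}e^{\eta K}, \] \[ \mathbb P\bigl(V_{m+n}\ge M\,\big|\,\mathcal F_m\bigr)\le\rho^n e^{\eta(V_m-M)}+\frac{1-\rho^n}{1-\rho}\,e^{\eta(1+\alpha)}e^{\eta(K-M)}, \] \[ \mathbb P\bigl(\tau_{K,m}>n\,\big|\,\mathcal F_m\bigr)\le e^{\eta(V_m-K)}\rho^n, \] where $\tau_{K,m}:=\min\{j\ge0:\ V_{m+j}\le K\}$. In particular, since $X_n^{(o)}\le V_n$ and $X_n^{(i)}\le(1+k/\alpha)V_n$ for all $i\in\mathcal N$, the observer and local tip pool sizes inherit exponential tail bounds up to the deterministic rescaling of thresholds: both $\mathbb P(X_{m+n}^{(o)}\ge M\mid\mathcal F_m)$ and, for every $i\in\mathcal N$, $\mathbb P(X_{m+n}^{(i)}\ge(1+k/\alpha)M\mid\mathcal F_m)$ are bounded by the right-hand side of the second display.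
   Context: **Model.** Let $\mathcal N=\{1,\dots,N\}$ be a finite set of nodes, $k\ge2$ an integer, $\lambda>0$ and $0\le\Delta<\infty$. Blocks are issued at times $0<t_1<t_2<\cdots$ forming a homogeneous Poisson process on $\mathbb R_+$ with rate $\lambda$; put $t_0:=0$. Block $n\ge1$, issued at $t_n$, carries a mark $\kappa_n=(\mathrm{blockID}_n,\mathrm{Ref}_n,\mathrm{nodeID}_n,\mathrm{delay}_n)$, where: - $\mathrm{blockID}_n$ are i.i.d. $\mathrm{Unif}[0,1]$, independent of the Poisson process (hence a.s. distinct); blocks are identified with their identifiers; - the issuers $\mathrm{nodeID}_n$ are i.i.d. $\mathcal N$-valued, independent of everything else; - $\mathrm{delay}_n=(\mathrm{delay}_n(j))_{j\in\mathcal N}$, where $\mathrm{delay}_n(j)\ge0$ is the time after $t_n$ until node $j$ receives block $n$. Delays are i.i.d. across blocks: if the issuer is $i$, the vector is drawn from a law depending only on $i$, with $j$-th coordinate distributed as $\Delta_i(j)$, and $\mathrm{delay}_n(i)=0$ for the issuer $i$. Conditional on $(t_m,\mathrm{blockID}_m,\mathrm{nodeID}_m)_{m\le n}$, $\mathrm{delay}_n$ is independent of the past. Partial synchrony: $\mathbb P(\Delta_i(j)\le\Delta)=1$ for all $i,j\in\mathcal N$; - $\mathrm{Ref}_n$ is the list of earlier blocks referenced by block $n$, defined below. Let $\mathcal F_n=\sigma((t_1,\kappa_1),\dots,(t_n,\kappa_n))$. There is a genesis block $\star$, visible to all nodes from time $0$. Messages with arrival time at most $t_n$ are processed before block $n$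 is issued. For $i\in\mathcal N$, the pre-issuance local tip pool is \[\mathrm{pool}_n^-(i)=\Bigl(\{\star\}\cup\{\mathrm{blockID}_m: m<n,\ t_m+\mathrm{delay}_m(i)\le t_n\}\Bigr)\setminus\bigcup_{m<n:\,t_m+\mathrm{delay}_m(i)\le t_n}\{\text{entries of }\mathrm{Ref}_m\}.\] $\mathrm{Ref}_n$ consists of $\min\{k,|\mathrm{pool}_n^-(\mathrm{nodeID}_n)|\}$ distinct elements sampled uniformly without replacement from $\mathrm{pool}_n^-(\mathrm{nodeID}_n)$. The post-issuance local tip pool $\mathrm{pool}_n(i)$ is defined by the same formula with $m<n$ replaced by $m\le n$. The observer tip pool is $\mathrm{pool}_n^{(o)}=\bigl(\{\star\}\cup\{\mathrm{blockID}_1,\dots,\mathrm{blockID}_n\}\bigr)\setminus\bigcup_{m=1}^n\{\text{entries of }\mathrm{Ref}_m\}$. At $n=0$ all pools equal $\{\star\}$. Put $X_n^{(o)}=|\mathrm{pool}_n^{(o)}|$, $X_n^{(i)}=|\mathrm{pool}_n(i)|$, and $L_n=|\{m\in\{1,\dots,n\}: t_m\in(t_n-\Delta,t_n]\}|$ for $n\ge1$, $L_0=0$. **Choice of constants.** Let $q=e^{-\lambda\Delta}$ and $\gamma(\phi)=\frac{1-(k+1)\phi}{1+k\phi}$ for $\phi\in[0,(k+1)^{-1})$. Fix $\beta\in(0,(k+1)^{-1})$ with $\gamma(\beta)^2>\frac34$; fix $K_0<\infty$ such that $\frac1x\le\gamma(\beta)^2-\frac34$ and $x(1-(k+1)\beta)\ge2$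 for all $x\ge K_0$; set $\varepsilon_X=\frac12$; fix $\alpha$ with $0<\alpha\le\varepsilon_X/2=\frac14$; set \[\ell_0=\Bigl\lceil\frac{2(1+\alpha)}{\alpha q}\Bigr\rceil,\qquad K=\max\{K_0,\ \ell_0/\beta\}+\alpha\ell_0+1 .\] (With these choices, for some $\varepsilon>0$, $\mathbb E[V_{n+1}-V_n\mid\mathcal F_n]\le-\varepsilon$ on $\{V_n\ge K\}$ for all $n\ge0$.) *)

theory Defs
  imports "HOL-Probability.Probability" "HOL-Library.Extended_Nat"
begin

section \<open>Measure-theoretic preliminaries\<close>

text \<open>Finite lists over a measurable space: the disjoint union over \<open>n\<close> of the \<open>n\<close>-fold
  product spaces (\<open>listset [A\<^sub>1, \<dots>, A\<^sub>n]\<close> is the box of lists \<open>[x\<^sub>1, \<dots>, x\<^sub>n]\<close> with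
  \<open>x\<^sub>i \<in> A\<^sub>i\<close>).\<close>

definition list_space :: "'a measure \<Rightarrow> 'a list measure" where
  "list_space S = sigma (lists (space S)) {listset As | As. set As \<subseteq> sets S}"

text \<open>The \<open>\<sigma>\<close>-algebra \<open>\<sigma>(X)\<close> on the sample space generated by an \<open>S\<close>-valued random variable.\<close>

abbreviation generated :: "'w measure \<Rightarrow> 'b measure \<Rightarrow> ('w \<Rightarrow> 'b) \<Rightarrow> 'w measure" where
  "generated M S X \<equiv> vimage_algebra (space M) X S"

definition cprob :: "'w measure \<Rightarrow> 'w measure \<Rightarrow> ('w \<Rightarrow> bool) \<Rightarrow> 'w \<Rightarrow> real" where
  "cprob M F P = real_cond_exp M F (indicat_real {\<omega> \<in> space M. P \<omega>})"

text \<open>\<open>X\<close> has (regular) conditional law \<open>Q \<omega>\<close> given \<open>F\<close>.\<close>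

definition has_cond_law ::
    "'w measure \<Rightarrow> 'w measure \<Rightarrow> 'b measure \<Rightarrow> ('w \<Rightarrow> 'b) \<Rightarrow> ('w \<Rightarrow> 'b measure) \<Rightarrow> bool" where
  "has_cond_law M F S X Q \<longleftrightarrow> X \<in> measurable M S \<and>
     (\<forall>B\<in>sets S. AE \<omega> in M. cprob M F (\<lambda>\<omega>'. X \<omega>' \<in> B) \<omega> = measure (Q \<omega>) B)"

section \<open>Blocks, tip pools and the history\<close>

text \<open>The node set is the finite type \<open>'v\<close>. A mark is
  \<open>\<kappa>\<^sub>n = (blockID\<^sub>n, Ref\<^sub>n, nodeID\<^sub>n, delay\<^sub>n)\<close> and the process is
  \<open>\<xi> n \<omega> = (t\<^sub>n, \<kappa>\<^sub>n)\<close> for \<open>n \<ge> 1\<close>; the value \<open>\<xi> 0\<close> is never used.\<close>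

type_synonym 'v mark = "real \<times> real list \<times> 'v \<times> ('v \<Rightarrow> real)"
type_synonym ('w, 'v) blocks = "nat \<Rightarrow> 'w \<Rightarrow> real \<times> 'v mark"

definition issue_time :: "('w, 'v) blocks \<Rightarrow> nat \<Rightarrow> 'w \<Rightarrow> real" where
  "issue_time \<xi> n \<omega> = (if n = 0 then 0 else fst (\<xi> n \<omega>))"

definition blockID :: "('w, 'v) blocks \<Rightarrow> nat \<Rightarrow> 'w \<Rightarrow> real" where
  "blockID \<xi> n \<omega> = fst (snd (\<xi> n \<omega>))"

definition Ref :: "('w, 'v) blocks \<Rightarrow> nat \<Rightarrow> 'w \<Rightarrow> real list" where
  "Ref \<xi> n \<omega> = fst (snd (snd (\<xi> n \<omega>)))"

definition nodeID :: "('w, 'v) blocks \<Rightarrow> nat \<Rightarrow> 'w \<Rightarrow> 'v" where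
  "nodeID \<xi> n \<omega> = fst (snd (snd (snd (\<xi> n \<omega>))))"

definition delay :: "('w, 'v) blocks \<Rightarrow> nat \<Rightarrow> 'w \<Rightarrow> 'v \<Rightarrow> real" where
  "delay \<xi> n \<omega> = snd (snd (snd (snd (\<xi> n \<omega>))))"

text \<open>Blocks are identified with their identifiers, which lie in \<open>[0,1]\<close>; the genesis block gets
  an identifier outside this range.\<close>

definition genesis :: real where
  "genesis = - 1"

text \<open>The tips of the sub-history consisting of genesis and the blocks with index in \<open>I\<close>.\<close>

definition tips :: "('w, 'v) blocks \<Rightarrow> nat set \<Rightarrow> 'w \<Rightarrow> real set" where
  "tips \<xi> I \<omega> = ({genesis} \<union> (\<lambda>m. blockID \<xi> m \<omega>) ` I) - (\<Union>m\<in>I. set (Ref \<xi> m \<omega>))"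

definition pool_pre :: "('w, 'v) blocks \<Rightarrow> nat \<Rightarrow> 'v \<Rightarrow> 'w \<Rightarrow> real set" where
  "pool_pre \<xi> n i \<omega> =
     tips \<xi> {m. 1 \<le> m \<and> m < n \<and> issue_time \<xi> m \<omega> + delay \<xi> m \<omega> i \<le> issue_time \<xi> n \<omega>} \<omega>"

definition pool :: "('w, 'v) blocks \<Rightarrow> nat \<Rightarrow> 'v \<Rightarrow> 'w \<Rightarrow> real set" where
  "pool \<xi> n i \<omega> =
     tips \<xi> {m. 1 \<le> m \<and> m \<le> n \<and> issue_time \<xi> m \<omega> + delay \<xi> m \<omega> i \<le> issue_time \<xi> n \<omega>} \<omega>"

definition pool_obs :: "('w, 'v) blocks \<Rightarrow> nat \<Rightarrow> 'w \<Rightarrow> real set" where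
  "pool_obs \<xi> n \<omega> = tips \<xi> {1..n} \<omega>"

definition X_obs :: "('w, 'v) blocks \<Rightarrow> nat \<Rightarrow> 'w \<Rightarrow> nat" where
  "X_obs \<xi> n \<omega> = card (pool_obs \<xi> n \<omega>)"

definition X_loc :: "('w, 'v) blocks \<Rightarrow> 'v \<Rightarrow> nat \<Rightarrow> 'w \<Rightarrow> nat" where
  "X_loc \<xi> i n \<omega> = card (pool \<xi> n i \<omega>)"

definition L :: "('w, 'v) blocks \<Rightarrow> real \<Rightarrow> nat \<Rightarrow> 'w \<Rightarrow> nat" where
  "L \<xi> \<Delta> n \<omega> =
     card {m \<in> {1..n}. issue_time \<xi> m \<omega> \<in> {issue_time \<xi> n \<omega> - \<Delta> <.. issue_time \<xi> n \<omega>}}"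

definition V :: "('w, 'v) blocks \<Rightarrow> real \<Rightarrow> real \<Rightarrow> nat \<Rightarrow> 'w \<Rightarrow> real" where
  "V \<xi> \<Delta> \<alpha> n \<omega> = real (X_obs \<xi> n \<omega>) + \<alpha> * real (L \<xi> \<Delta> n \<omega>)"

text \<open>\<open>\<tau>\<^bsub>K,m\<^esub> = min {j \<ge> 0. V\<^bsub>m+j\<^esub> \<le> K}\<close>, with value \<open>\<infinity>\<close> if there is no such \<open>j\<close>.\<close>

definition hit_time ::
    "('w, 'v) blocks \<Rightarrow> real \<Rightarrow> real \<Rightarrow> real \<Rightarrow> nat \<Rightarrow> 'w \<Rightarrow> enat" where
  "hit_time \<xi> \<Delta> \<alpha> K m \<omega> = (INF j\<in>{j. V \<xi> \<Delta> \<alpha> (m + j) \<omega> \<le> K}. enat j)"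

abbreviation delay_space :: "('v \<Rightarrow> real) measure" where
  "delay_space \<equiv> PiM UNIV (\<lambda>_. borel)"

abbreviation block_space :: "(real \<times> 'v mark) measure" where
  "block_space \<equiv> borel \<Otimes>\<^sub>M (borel \<Otimes>\<^sub>M list_space borel \<Otimes>\<^sub>M count_space UNIV \<Otimes>\<^sub>M delay_space)"

abbreviation past_space :: "nat \<Rightarrow> (nat \<Rightarrow> real \<times> 'v mark) measure" where
  "past_space n \<equiv> PiM {1..n} (\<lambda>_. block_space)"

definition past :: "('w, 'v) blocks \<Rightarrow> nat \<Rightarrow> 'w \<Rightarrow> nat \<Rightarrow> real \<times> 'v mark" where
  "past \<xi> n \<omega> = (\<lambda>m\<in>{1..n}. \<xi> m \<omega>)"

text \<open>\<open>\<F>\<^sub>n = \<sigma>((t\<^sub>1, \<kappa>\<^sub>1), \<dots>, (t\<^sub>n, \<kappa>\<^sub>n))\<close>.\<close>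

definition hist :: "'w measure \<Rightarrow> ('w, 'v) blocks \<Rightarrow> nat \<Rightarrow> 'w measure" where
  "hist M \<xi> n = generated M (past_space n) (past \<xi> n)"

text \<open>\<open>hist_issue\<close> adds \<open>(t\<^sub>n, blockID\<^sub>n, nodeID\<^sub>n)\<close> to \<open>\<F>\<^bsub>n-1\<^esub>\<close>, and \<open>hist_delay\<close> moreover adds
  \<open>delay\<^sub>n\<close>.\<close>

definition hist_issue :: "'w measure \<Rightarrow> ('w, 'v) blocks \<Rightarrow> nat \<Rightarrow> 'w measure" where
  "hist_issue M \<xi> n = generated M
     (past_space (n - 1) \<Otimes>\<^sub>M borel \<Otimes>\<^sub>M borel \<Otimes>\<^sub>M count_space UNIV)
     (\<lambda>\<omega>. (past \<xi> (n - 1) \<omega>, issue_time \<xi> n \<omega>, blockID \<xi> n \<omega>, nodeID \<xi> n \<omega>))"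

definition hist_delay :: "'w measure \<Rightarrow> ('w, 'v) blocks \<Rightarrow> nat \<Rightarrow> 'w measure" where
  "hist_delay M \<xi> n = generated M
     (past_space (n - 1) \<Otimes>\<^sub>M borel \<Otimes>\<^sub>M borel \<Otimes>\<^sub>M count_space UNIV \<Otimes>\<^sub>M delay_space)
     (\<lambda>\<omega>. (past \<xi> (n - 1) \<omega>, issue_time \<xi> n \<omega>, blockID \<xi> n \<omega>, nodeID \<xi> n \<omega>, delay \<xi> n \<omega>))"

section \<open>The probabilistic model\<close>

text \<open>Arrival times \<open>T\<^sub>0 = 0, T\<^sub>1, T\<^sub>2, \<dots>\<close> of a homogeneous Poisson process: the gaps are
  i.i.d. exponential.\<close>

definition (in prob_space) poisson_arrivals :: "real \<Rightarrow> (nat \<Rightarrow> 'a \<Rightarrow> real) \<Rightarrow> bool" where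
  "poisson_arrivals r T \<longleftrightarrow> (\<forall>\<omega>. T 0 \<omega> = 0) \<and>
     indep_vars (\<lambda>_. borel) (\<lambda>n \<omega>. T (Suc n) \<omega> - T n \<omega>) UNIV \<and>
     (\<forall>n. distributed M lborel (\<lambda>\<omega>. T (Suc n) \<omega> - T n \<omega>) (exponential_density r))"

text \<open>Ordered samples of \<open>r\<close> elements of \<open>A\<close> without replacement.\<close>

definition samples :: "nat \<Rightarrow> 'b set \<Rightarrow> 'b list set" where
  "samples r A = {xs. distinct xs \<and> set xs \<subseteq> A \<and> length xs = r}"

text \<open>\<open>\<nu>\<close> is the law of the issuers and \<open>D i\<close> the law of the delay vector of a block issued by
  node \<open>i\<close>; the law of \<open>\<Delta>\<^sub>i(j)\<close> is the \<open>j\<close>-th marginal of \<open>D i\<close>.\<close>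

locale block_model = prob_space M
  for M :: "'w measure" +
  fixes rate \<Delta> :: real and k :: nat
    and \<nu> :: "'v::finite pmf" and D :: "'v \<Rightarrow> ('v \<Rightarrow> real) measure"
    and \<xi> :: "('w, 'v) blocks"
  assumes rate_pos: "rate > 0"
    and Delta_nonneg: "\<Delta> \<ge> 0"
    and k_ge_2: "k \<ge> 2"
    and D_prob: "\<And>i. prob_space (D i)"
    and D_sets: "\<And>i. sets (D i) = sets delay_space"
    and D_nonneg: "\<And>i j. AE d in D i. d j \<ge> 0"
    and D_issuer: "\<And>i. AE d in D i. d i = 0"
    and partial_synchrony: "\<And>i j. AE d in D i. d j \<le> \<Delta>"
    and poisson: "poisson_arrivals rate (issue_time \<xi>)"
    and blockID_indep: "indep_vars (\<lambda>_. borel) (blockID \<xi>) {1..}"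
    and blockID_uniform:
      "\<And>n. n \<ge> 1 \<Longrightarrow> distr M borel (blockID \<xi> n) = uniform_measure lborel {0..1}"
    and blockID_indep_poisson: "indep_set
      (sets (generated M (PiM {1..} (\<lambda>_. borel)) (\<lambda>\<omega>. \<lambda>n\<in>{1..}. blockID \<xi> n \<omega>)))
      (sets (generated M (PiM UNIV (\<lambda>_. borel)) (\<lambda>\<omega> n. issue_time \<xi> n \<omega>)))"
    and nodeID_indep: "indep_vars (\<lambda>_. count_space UNIV) (nodeID \<xi>) {1..}"
    and nodeID_law: "\<And>n. n \<ge> 1 \<Longrightarrow> distr M (count_space UNIV) (nodeID \<xi> n) = measure_pmf \<nu>"
    and nodeID_indep_rest: "indep_set
      (sets (generated M (PiM {1..} (\<lambda>_. count_space UNIV)) (\<lambda>\<omega>. \<lambda>n\<in>{1..}. nodeID \<xi> n \<omega>)))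
      (sets (generated M (PiM UNIV (\<lambda>_. borel) \<Otimes>\<^sub>M PiM {1..} (\<lambda>_. borel))
         (\<lambda>\<omega>. (\<lambda>n. issue_time \<xi> n \<omega>, \<lambda>n\<in>{1..}. blockID \<xi> n \<omega>))))"
    \<comment> \<open>issuance is exogenous: what is freshly drawn for block \<open>n + 1\<close> is independent of the
      whole past, including earlier delays and reference choices\<close>
    and innovation_indep: "\<And>n. indep_set
      (sets (generated M (borel \<Otimes>\<^sub>M borel \<Otimes>\<^sub>M count_space UNIV)
         (\<lambda>\<omega>. (issue_time \<xi> (Suc n) \<omega> - issue_time \<xi> n \<omega>,
               blockID \<xi> (Suc n) \<omega>, nodeID \<xi> (Suc n) \<omega>))))
      (sets (hist M \<xi> n))"
    and delay_law: "\<And>n. n \<ge> 1 \<Longrightarrow>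
      has_cond_law M (hist_issue M \<xi> n) delay_space (delay \<xi> n) (\<lambda>\<omega>. D (nodeID \<xi> n \<omega>))"
    and Ref_law: "\<And>n. n \<ge> 1 \<Longrightarrow>
      has_cond_law M (hist_delay M \<xi> n) (list_space borel) (Ref \<xi> n)
        (\<lambda>\<omega>. let P = pool_pre \<xi> n (nodeID \<xi> n \<omega>) \<omega>
              in measure_pmf (pmf_of_set (samples (min k (card P)) P)))"

section \<open>Choice of constants\<close>

definition gamma_fun :: "nat \<Rightarrow> real \<Rightarrow> real" where
  "gamma_fun k \<phi> = (1 - (real k + 1) * \<phi>) / (1 + real k * \<phi>)"

definition epsilon_X :: real where
  "epsilon_X = 1 / 2"

definition ell_0 :: "real \<Rightarrow> real \<Rightarrow> real \<Rightarrow> int" where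
  "ell_0 rate \<Delta> \<alpha> = (let q = exp (- rate * \<Delta>) in \<lceil>2 * (1 + \<alpha>) / (\<alpha> * q)\<rceil>)"

text \<open>\<open>\<alpha>\<close> and \<open>K\<close> arise from some admissible choice of \<open>\<beta>\<close> and \<open>K\<^sub>0\<close>. The condition
  \<open>x (1 - (k+1) \<beta>) \<ge> 2\<close> forces \<open>K\<^sub>0 > 0\<close>, so \<open>1 / x\<close> is a genuine reciprocal.\<close>

definition admissible_constants ::
    "real \<Rightarrow> real \<Rightarrow> nat \<Rightarrow> real \<Rightarrow> real \<Rightarrow> real \<Rightarrow> real \<Rightarrow> bool" where
  "admissible_constants rate \<Delta> k \<beta> K\<^sub>0 \<alpha> K \<longleftrightarrow>
     0 < \<beta> \<and> \<beta> < 1 / (real k + 1) \<and> (gamma_fun k \<beta>)\<^sup>2 > 3 / 4 \<and>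
     (\<forall>x\<ge>K\<^sub>0. 1 / x \<le> (gamma_fun k \<beta>)\<^sup>2 - 3 / 4 \<and> x * (1 - (real k + 1) * \<beta>) \<ge> 2) \<and>
     0 < \<alpha> \<and> \<alpha> \<le> epsilon_X / 2 \<and>
     K = max K\<^sub>0 (of_int (ell_0 rate \<Delta> \<alpha>) / \<beta>) + \<alpha> * of_int (ell_0 rate \<Delta> \<alpha>) + 1"

end

theory Submission
  imports Defs
begin

text \<open>The functional \<open>V\<close> trades the number of tips seen by the observer against the number
  \<open>L\<close> of blocks issued during the last \<open>\<Delta>\<close> time units, and \<open>exp (\<eta> V)\<close> contracts in conditional
  mean whenever \<open>V > K\<close>. One step raises \<open>V\<close> by at most \<open>1 + \<alpha>\<close>, since one block arrives. Against
  this there are two sources of decrease, depending on which summand makes \<open>V\<close> large.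

  If \<open>L\<^sub>n \<ge> \<ell>\<^sub>0\<close>, then with probability \<open>q = exp (- \<lambda> \<Delta>)\<close>, independently of the past, the next gap
  exceeds \<open>\<Delta>\<close>; all recent blocks then leave the window and \<open>V\<close> ends at least \<open>\<alpha> \<ell>\<^sub>0\<close> below that
  bound, where \<open>q \<alpha> \<ell>\<^sub>0 \<ge> 2 (1 + \<alpha>)\<close> by the choice of \<open>\<ell>\<^sub>0\<close> (lemma \<open>drift_many_recent\<close>).

  If \<open>L\<^sub>n < \<ell>\<^sub>0\<close> and \<open>V\<^sub>n > K\<close>, the observer has so many tips that the at most \<open>L\<^sub>n\<close> blocks hidden
  from the next issuer are a small fraction of them. Each hidden block removes at most one observer
  tip from the issuer's pool and leaves at most \<open>k\<close> stale entries in it, so at least \<open>4/5\<close> of the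
  pool consists of observer tips (lemma \<open>tip_fraction\<close>). At least two references are drawn from
  this pool, and each is uniform on it, so on average at least \<open>8/5 > 1 + \<alpha>\<close> observer tips are
  covered (lemma \<open>drift_few_recent\<close>).

  In both cases a bounded part of the decrease suffices, and convexity turns a conditional mean
  of at least \<open>p b\<close> for a decrease in \<open>[0, b]\<close> into the factor
  \<open>exp (\<eta> (1 + \<alpha>)) (1 - p (1 - exp (- \<eta> b)))\<close>. Its derivative at \<open>\<eta> = 0\<close> is \<open>1 + \<alpha> - p b < 0\<close>, so
  it is below \<open>1\<close> for small \<open>\<eta>\<close>; \<open>\<rho>\<close> is the larger of the two factors. Iterating the one-step bound
  gives the moment estimate, iterating it for the process killed on entering \<open>{V \<le> K}\<close> gives the
  estimate of the hitting time, and Markov's inequality gives the tails. For a local pool,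
  \<open>X\<^sup>(\<^sup>i\<^sup>) \<le> X\<^sup>(\<^sup>o\<^sup>) + k L\<close> almost surely, by the same count of stale entries.

  The main measure-theoretic point is that the references are sampled from a random set, while
  the conditional law of the model speaks about fixed sets of lists. As pools are finite, a
  countable family of Borel sets suffices to separate observer tips from the other pool elements
  (lemma \<open>cprob_Ref_nth_in_obs_ge\<close>).\<close>

section \<open>Measurability of finite lists\<close>

lemma listset_replicate: "listset (replicate n A) = {xs. length xs = n \<and> set xs \<subseteq> A}"
proof (induction n)
  case (Suc n)
  show ?case
  proof (intro set_eqI iffI)
    fix xs assume "xs \<in> {xs. length xs = Suc n \<and> set xs \<subseteq> A}"
    then show "xs \<in> listset (replicate (Suc n) A)"
      using Suc by (cases xs) (auto simp: set_Cons_def)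
  qed (use Suc in \<open>auto simp: set_Cons_def\<close>)
qed auto

lemma listset_nth: "listset As = {xs. length xs = length As \<and> (\<forall>i<length As. xs ! i \<in> As ! i)}"
proof (induction As)
  case (Cons A As)
  show ?case
  proof (intro set_eqI iffI)
    fix xs assume "xs \<in> {xs. length xs = length (A # As) \<and> (\<forall>i<length (A # As). xs ! i \<in> (A # As) ! i)}"
    then show "xs \<in> listset (A # As)"
      using Cons by (cases xs) (auto simp: set_Cons_def)
  next
    fix xs assume "xs \<in> listset (A # As)"
    then show "xs \<in> {xs. length xs = length (A # As) \<and> (\<forall>i<length (A # As). xs ! i \<in> (A # As) ! i)}"
      using Cons by (auto simp: set_Cons_def less_Suc_eq_0_disj)
  qed
qed auto

lemma space_list_space: "space (list_space S) = lists (space S)"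
  by (simp add: list_space_def space_measure_of_conv)

lemma listset_in_list_space: "set As \<subseteq> sets S \<Longrightarrow> listset As \<in> sets (list_space S)"
proof -
  have sub: "{listset As | As. set As \<subseteq> sets S} \<subseteq> Pow (lists (space S))"
  proof safe
    fix As xs x assume "set As \<subseteq> sets S" "xs \<in> listset As" "x \<in> set xs"
    then show "x \<in> space S"
      by (auto simp: listset_nth in_set_conv_nth dest!: spec) (metis nth_mem sets.sets_into_space subsetD)
  qed
  assume "set As \<subseteq> sets S"
  then show ?thesis
    unfolding list_space_def sets_measure_of[OF sub] by (intro sigma_sets.Basic) auto
qed

lemma measurable_length_list_space [measurable]:
  "length \<in> measurable (list_space S) (count_space UNIV)"
proof (rule measurable_count_space_eq2_countable[THEN iffD2], simp, safe)
  fix n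
  have "length -` {n} \<inter> space (list_space S) = listset (replicate n (space S))"
    by (auto simp: listset_replicate space_list_space)
  also have "\<dots> \<in> sets (list_space S)"
    by (rule listset_in_list_space) auto
  finally show "length -` {n} \<inter> space (list_space S) \<in> sets (list_space S)" .
qed

lemma nth_in_list_space [measurable]:
  fixes B :: "real set"
  assumes B: "B \<in> sets borel"
  shows "{xs. j < length xs \<and> xs ! j \<in> B} \<in> sets (list_space borel)"
proof -
  have "{xs. j < length xs \<and> xs ! j \<in> B} =
      (\<Union>n\<in>{j<..}. listset ((replicate n UNIV)[j := B]))"
    by (auto simp: listset_nth nth_list_update)
  also have "\<dots> \<in> sets (list_space borel)"
  proof (intro sets.countable_UN listset_in_list_space image_subsetI)
    fix n
    show "set ((replicate n UNIV)[j := B]) \<subseteq> sets borel"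
      using B set_update_subset_insert[of "replicate n UNIV" j B] by (auto split: if_splits)
  qed
  finally show ?thesis .
qed

text \<open>Total version of \<open>nth\<close>: a fixed value beyond the end makes each coordinate a measurable map
  on all lists.\<close>

definition entry :: "real list \<Rightarrow> nat \<Rightarrow> real" where
  "entry xs j = (if j < length xs then xs ! j else 0)"

lemma measurable_entry [measurable]: "(\<lambda>xs. entry xs j) \<in> borel_measurable (list_space borel)"
proof (rule measurableI)
  fix B :: "real set" assume [measurable]: "B \<in> sets borel"
  have "(\<lambda>xs. entry xs j) -` B \<inter> space (list_space borel) =
     {xs. j < length xs \<and> xs ! j \<in> B} \<union> {xs \<in> space (list_space borel). \<not> j < length xs \<and> 0 \<in> B}"
    by (auto simp: space_list_space entry_def split: if_splits)
  also have "\<dots> \<in> sets (list_space borel)"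
    by measurable
  finally show "(\<lambda>xs. entry xs j) -` B \<inter> space (list_space borel) \<in> sets (list_space borel)" .
qed auto

lemma pred_member_list_space [measurable (raw)]:
  assumes [measurable]: "g \<in> borel_measurable G" "R \<in> measurable G (list_space borel)"
  shows "Measurable.pred G (\<lambda>\<omega>. (g \<omega> :: real) \<in> set (R \<omega>))"
proof -
  have "(\<lambda>\<omega>. g \<omega> \<in> set (R \<omega>)) = (\<lambda>\<omega>. \<exists>j. j < length (R \<omega>) \<and> g \<omega> = entry (R \<omega>) j)"
    unfolding fun_eq_iff in_set_conv_nth entry_def by (metis (full_types))
  then show ?thesis
    by simp
qed

lemma distinct_bounded_in_list_space:
  "{xs :: real list. distinct xs \<and> length xs \<le> r} \<in> sets (list_space borel)"
proof -
  have eq: "distinct xs \<longleftrightarrow> (\<forall>i j. i < length xs \<longrightarrow> j < length xs \<longrightarrow> i \<noteq> j \<longrightarrow> entry xs i \<noteq> entry xs j)"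
    for xs :: "real list"
    unfolding distinct_conv_nth entry_def by simp
  have "{xs \<in> space (list_space (borel :: real measure)). distinct xs \<and> length xs \<le> r} \<in> sets (list_space borel)"
    unfolding eq by measurable
  moreover have "{xs \<in> space (list_space borel). distinct xs \<and> length xs \<le> r} =
      {xs :: real list. distinct xs \<and> length xs \<le> r}"
    by (auto simp: space_list_space)
  ultimately show ?thesis
    by metis
qed

section \<open>Uniform sampling without replacement\<close>

lemma finite_samples: "finite A \<Longrightarrow> finite (samples r A)"
  by (rule finite_subset[OF _ finite_lists_length_eq[of A r]]) (auto simp: samples_def)

lemma samples_nonempty:
  assumes "finite A" "r \<le> card A"
  shows "samples r A \<noteq> {}"
proof -
  obtain B where "B \<subseteq> A" "card B = r"
    using assms by (meson obtain_subset_with_card_n)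
  moreover from this obtain xs where "set xs = B" "distinct xs"
    using assms(1) finite_distinct_list finite_subset by metis
  ultimately have "xs \<in> samples r A"
    by (auto simp: samples_def distinct_card)
  then show ?thesis by auto
qed

text \<open>Swapping two elements of \<open>A\<close> permutes the samples, so every element of \<open>A\<close> occurs equally often
  in position \<open>j\<close>.\<close>

lemma prob_sample_nth:
  assumes "finite A" "r \<le> card A" "j < r"
  shows "measure (measure_pmf (pmf_of_set (samples r A))) {xs. j < length xs \<and> xs ! j \<in> U}
    = card (A \<inter> U) / card A"
proof -
  define c where "c a = card {xs \<in> samples r A. xs ! j = a}" for a
  note fin = finite_samples[OF assms(1), of r]
  have inA: "xs ! j \<in> A" if "xs \<in> samples r A" for xs
    using that assms(3) by (auto simp: samples_def)
  have c_le: "c a \<le> c b" if "a \<in> A" "b \<in> A" for a b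
    unfolding c_def
  proof (rule card_inj_on_le)
    show "inj_on (map (Transposition.transpose a b)) {xs \<in> samples r A. xs ! j = a}"
      by (intro inj_on_subset[OF list.inj_map]) auto
    show "map (Transposition.transpose a b) ` {xs \<in> samples r A. xs ! j = a} \<subseteq> {xs \<in> samples r A. xs ! j = b}"
      using that assms(3)
      by (auto simp: samples_def distinct_map Transposition.transpose_def split: if_splits intro!: inj_on_subset[OF inj_transpose])
    show "finite {xs \<in> samples r A. xs ! j = b}"
      using fin by simp
  qed
  have "A \<noteq> {}" using assms by auto
  then obtain a0 where a0: "a0 \<in> A" by auto
  have c_eq: "c a = c a0" if "a \<in> A" for a
    using c_le a0 that by (metis le_antisym)
  have count: "card {xs \<in> samples r A. xs ! j \<in> W} = card (A \<inter> W) * c a0" for W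
  proof -
    have "{xs \<in> samples r A. xs ! j \<in> W} = (\<Union>a\<in>A \<inter> W. {xs \<in> samples r A. xs ! j = a})"
      using inA by auto
    also have "card \<dots> = (\<Sum>a\<in>A \<inter> W. c a)"
      unfolding c_def using fin assms(1) by (intro card_UN_disjoint) auto
    also have "\<dots> = card (A \<inter> W) * c a0"
      using c_eq by simp
    finally show ?thesis .
  qed
  have tot: "card (samples r A) = card A * c a0"
    using count[of UNIV] by simp
  have pos: "card (samples r A) > 0"
    using samples_nonempty[OF assms(1,2)] fin by (simp add: card_gt_0_iff)
  have "samples r A \<inter> {xs. j < length xs \<and> xs ! j \<in> U} = {xs \<in> samples r A. xs ! j \<in> U}"
    using assms(3) by (auto simp: samples_def)
  then have "measure (measure_pmf (pmf_of_set (samples r A))) {xs. j < length xs \<and> xs ! j \<in> U}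
    = card {xs \<in> samples r A. xs ! j \<in> U} / card (samples r A)"
    using measure_pmf_of_set[OF samples_nonempty[OF assms(1,2)] fin, of "{xs. j < length xs \<and> xs ! j \<in> U}"] by simp
  also have "\<dots> = card (A \<inter> U) / card A"
    using pos unfolding count tot by (simp add: field_simps)
  finally show ?thesis .
qed

lemma prob_sample_distinct_bounded:
  assumes "finite A" "r \<le> card A" "r \<le> k"
  shows "measure (measure_pmf (pmf_of_set (samples r A))) {xs. distinct xs \<and> length xs \<le> k} = 1"
  using assms samples_nonempty[OF assms(1,2)] finite_samples[OF assms(1)]
  by (intro measure_pmf.prob_eq_1[THEN iffD2]) (auto simp: AE_measure_pmf_iff samples_def)

section \<open>Tips of sub-histories\<close>

text \<open>Giving genesis the index \<open>0\<close> enumerates all candidates for tips by \<open>{..n}\<close>.\<close>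

definition ident :: "('w, 'v) blocks \<Rightarrow> nat \<Rightarrow> 'w \<Rightarrow> real" where
  "ident \<xi> m \<omega> = (if m = 0 then genesis else blockID \<xi> m \<omega>)"

lemma tips_subset_ident:
  assumes "I \<subseteq> {1..n}"
  shows "tips \<xi> I \<omega> \<subseteq> (\<lambda>m. ident \<xi> m \<omega>) ` {..n}"
proof
  fix y assume "y \<in> tips \<xi> I \<omega>"
  then consider "y = ident \<xi> 0 \<omega>" | m where "m \<in> I" "y = ident \<xi> m \<omega>"
    using assms by (force simp: tips_def ident_def)
  then show "y \<in> (\<lambda>m. ident \<xi> m \<omega>) ` {..n}"
    using assms by cases auto
qed

lemma finite_tips: "I \<subseteq> {1..n} \<Longrightarrow> finite (tips \<xi> I \<omega>)"
  using tips_subset_ident finite_surj[OF finite_atMost] by metis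

text \<open>Counting each element at its first index writes the cardinality of a random finite set as a
  finite sum of indicators; this is how pool sizes are seen to be measurable even where identifiers
  coincide.\<close>

lemma card_enumerated:
  fixes f :: "nat \<Rightarrow> 'a"
  assumes "S \<subseteq> f ` {..n}"
  shows "card S = (\<Sum>m\<le>n. if f m \<in> S \<and> (\<forall>m'\<in>{..<m}. f m' \<noteq> f m) then 1 else 0)"
proof -
  let ?J = "{m\<in>{..n}. f m \<in> S \<and> (\<forall>m'\<in>{..<m}. f m' \<noteq> f m)}"
  have "bij_betw f ?J S"
  proof (rule bij_betw_imageI)
    show "inj_on f ?J"
    proof (rule inj_onI)
      fix x y assume "x \<in> ?J" "y \<in> ?J" "f x = f y"
      then show "x = y" by (cases x y rule: linorder_cases) force+
    qed
    show "f ` ?J = S"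
    proof (intro equalityI subsetI)
      fix y assume y: "y \<in> S"
      then obtain m where m: "m \<le> n" "f m = y" using assms by auto
      obtain l where l: "f l = y" "l \<le> m" "\<forall>m'\<in>{..<l}. f m' \<noteq> y"
        using m(2) exists_least_iff[of "\<lambda>m. f m = y"] by (metis lessThan_iff linorder_not_le)
      then have "l \<in> ?J" using m y by simp
      then show "y \<in> f ` ?J" using l(1) by blast
    qed auto
  qed
  then have "card S = card ?J" by (simp add: bij_betw_same_card)
  also have "\<dots> = (\<Sum>m\<in>?J. 1)" by simp
  also have "\<dots> = (\<Sum>m\<le>n. if f m \<in> S \<and> (\<forall>m'\<in>{..<m}. f m' \<noteq> f m) then 1 else 0)"
    by (subst sum.inter_filter) auto
  finally show ?thesis .
qed

lemma pred_member_tips: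
  assumes I: "\<And>\<omega>. I \<omega> \<subseteq> {1..n}"
    and mI: "\<And>m. m \<in> {1..n} \<Longrightarrow> Measurable.pred G (\<lambda>\<omega>. m \<in> I \<omega>)"
    and id: "\<And>m. m \<in> {1..n} \<Longrightarrow> blockID \<xi> m \<in> borel_measurable G"
    and R: "\<And>m. m \<in> {1..n} \<Longrightarrow> Ref \<xi> m \<in> measurable G (list_space borel)"
    and g: "g \<in> borel_measurable G"
  shows "Measurable.pred G (\<lambda>\<omega>. g \<omega> \<in> tips \<xi> (I \<omega>) \<omega>)"
proof -
  have eq: "g \<omega> \<in> tips \<xi> (I \<omega>) \<omega> \<longleftrightarrow>
      (g \<omega> = genesis \<or> (\<exists>m\<in>{1..n}. m \<in> I \<omega> \<and> g \<omega> = blockID \<xi> m \<omega>)) \<and>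
      \<not> (\<exists>m\<in>{1..n}. m \<in> I \<omega> \<and> g \<omega> \<in> set (Ref \<xi> m \<omega>))" for \<omega>
    using I[of \<omega>] by (auto simp: tips_def)
  have [measurable]: "Measurable.pred G (\<lambda>\<omega>. m \<in> I \<omega> \<and> g \<omega> = blockID \<xi> m \<omega>)"
    "Measurable.pred G (\<lambda>\<omega>. m \<in> I \<omega> \<and> g \<omega> \<in> set (Ref \<xi> m \<omega>))" if "m \<in> {1..n}" for m
    using mI[OF that] id[OF that] R[OF that] g by measurable
  show ?thesis
    unfolding eq using g by measurable
qed

lemma measurable_card_tips:
  assumes I: "\<And>\<omega>. I \<omega> \<subseteq> {1..n}"
    and mI: "\<And>m. m \<in> {1..n} \<Longrightarrow> Measurable.pred G (\<lambda>\<omega>. m \<in> I \<omega>)"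
    and id: "\<And>m. m \<in> {1..n} \<Longrightarrow> blockID \<xi> m \<in> borel_measurable G"
    and R: "\<And>m. m \<in> {1..n} \<Longrightarrow> Ref \<xi> m \<in> measurable G (list_space borel)"
  shows "(\<lambda>\<omega>. real (card (tips \<xi> (I \<omega>) \<omega>))) \<in> borel_measurable G"
proof -
  have ident: "ident \<xi> m \<in> borel_measurable G" if "m \<le> n" for m
    using id[of m] that by (cases "m = 0") (auto simp: ident_def[abs_def])
  have "(\<lambda>\<omega>. if ident \<xi> m \<omega> \<in> tips \<xi> (I \<omega>) \<omega> \<and> (\<forall>m'\<in>{..<m}. ident \<xi> m' \<omega> \<noteq> ident \<xi> m \<omega>) then 1 else 0 :: real)
      \<in> borel_measurable G" if m: "m \<le> n" for m
  proof -
    have "Measurable.pred G (\<lambda>\<omega>. ident \<xi> m' \<omega> \<noteq> ident \<xi> m \<omega>)" if "m' \<in> {..<m}" for m'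
    proof -
      have [measurable]: "ident \<xi> m' \<in> borel_measurable G" "ident \<xi> m \<in> borel_measurable G"
        using ident m that by auto
      show ?thesis by measurable
    qed
    then have [measurable]: "Measurable.pred G (\<lambda>\<omega>. \<forall>m'\<in>{..<m}. ident \<xi> m' \<omega> \<noteq> ident \<xi> m \<omega>)"
      by (intro pred_intros_finite) auto
    have [measurable]: "Measurable.pred G (\<lambda>\<omega>. ident \<xi> m \<omega> \<in> tips \<xi> (I \<omega>) \<omega>)"
      by (rule pred_member_tips[OF I mI id R ident[OF m]])
    show ?thesis by measurable
  qed
  then show ?thesis
    unfolding card_enumerated[OF tips_subset_ident[OF I]] of_nat_sum
    by (intro borel_measurable_sum) (simp add: if_distrib[of real] cong: if_cong)
qed

text \<open>The blocks outside \<open>I\<close> are those hidden from a node. An observer tip that the node does not see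
  as a tip must be a hidden block, and a tip of the node that is no observer tip must be referenced
  by a hidden block.\<close>

lemma card_tips_diff_le:
  assumes "I \<subseteq> {1..n}" and len: "\<And>m. m \<in> {1..n} \<Longrightarrow> length (Ref \<xi> m \<omega>) \<le> k"
  shows "card (tips \<xi> {1..n} \<omega> - tips \<xi> I \<omega>) \<le> card ({1..n} - I)"
    and "card (tips \<xi> I \<omega> - tips \<xi> {1..n} \<omega>) \<le> k * card ({1..n} - I)"
proof -
  have "tips \<xi> {1..n} \<omega> - tips \<xi> I \<omega> \<subseteq> (\<lambda>m. blockID \<xi> m \<omega>) ` ({1..n} - I)"
    using assms(1) unfolding tips_def by blast
  then show "card (tips \<xi> {1..n} \<omega> - tips \<xi> I \<omega>) \<le> card ({1..n} - I)"
    by (rule surj_card_le[rotated]) simp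
  have "tips \<xi> I \<omega> - tips \<xi> {1..n} \<omega> \<subseteq> (\<Union>m\<in>{1..n} - I. set (Ref \<xi> m \<omega>))"
    using assms(1) unfolding tips_def by blast
  then have "card (tips \<xi> I \<omega> - tips \<xi> {1..n} \<omega>) \<le> card (\<Union>m\<in>{1..n} - I. set (Ref \<xi> m \<omega>))"
    by (rule card_mono[rotated]) simp
  also have "\<dots> \<le> (\<Sum>m\<in>{1..n} - I. card (set (Ref \<xi> m \<omega>)))"
    by (rule card_UN_le) simp
  also have "\<dots> \<le> (\<Sum>m\<in>{1..n} - I. k)"
    by (intro sum_mono order_trans[OF card_length len]) auto
  finally show "card (tips \<xi> I \<omega> - tips \<xi> {1..n} \<omega>) \<le> k * card ({1..n} - I)"
    by (simp add: mult.commute)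
qed

text \<open>A new block removes the tips that it references and adds at most itself.\<close>

lemma card_tips_Suc_le:
  "card (tips \<xi> {1..Suc n} \<omega>) + card (tips \<xi> {1..n} \<omega> \<inter> set (Ref \<xi> (Suc n) \<omega>)) \<le> card (tips \<xi> {1..n} \<omega>) + 1"
proof -
  let ?O = "tips \<xi> {1..n} \<omega>" and ?R = "set (Ref \<xi> (Suc n) \<omega>)"
  have fin: "finite ?O" by (rule finite_tips[of _ n]) simp
  have "tips \<xi> {1..Suc n} \<omega> \<subseteq> insert (blockID \<xi> (Suc n) \<omega>) (?O - ?R)"
    by (auto simp: tips_def atLeastAtMostSuc_conv)
  then have "card (tips \<xi> {1..Suc n} \<omega>) \<le> card (insert (blockID \<xi> (Suc n) \<omega>) (?O - ?R))"
    using fin by (intro card_mono) auto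
  also have "\<dots> \<le> card (?O - ?R) + 1"
    unfolding card_insert_if[OF finite_Diff[OF fin]] by simp
  finally show ?thesis
    using card_Int_Diff[OF fin, of ?R] by simp
qed

section \<open>Conditional probabilities\<close>

lemma (in prob_space) sigma_finite_subalgebraI: "subalgebra M F \<Longrightarrow> sigma_finite_subalgebra M F"
proof -
  assume "subalgebra M F"
  then interpret finite_measure_subalgebra M F
    by unfold_locales
  show ?thesis
    by (rule sigma_finite_subalgebra_axioms)
qed

lemma (in prob_space) integrable_indicat: "A \<in> events \<Longrightarrow> integrable M (indicat_real A)"
  by (rule integrable_real_indicator) (auto simp: emeasure_eq_measure)

lemma (in prob_space) set_integral_cprob:
  assumes F: "subalgebra M F" and A: "A \<in> sets F" and B: "Measurable.pred M P"
  shows "(\<integral>\<omega>\<in>A. cprob M F P \<omega> \<partial>M) = prob (A \<inter> {\<omega> \<in> space M. P \<omega>})"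
proof -
  interpret sigma_finite_subalgebra M F by (rule sigma_finite_subalgebraI[OF F])
  have [measurable]: "A \<in> sets M" "{\<omega> \<in> space M. P \<omega>} \<in> sets M"
    using A F B by (auto simp: subalgebra_def)
  have "(\<integral>\<omega>\<in>A. cprob M F P \<omega> \<partial>M) = (\<integral>\<omega>\<in>A. indicat_real {\<omega> \<in> space M. P \<omega>} \<omega> \<partial>M)"
    unfolding cprob_def by (intro real_cond_exp_intA[symmetric] A integrable_indicat) fact
  also have "\<dots> = (\<integral>\<omega>. indicat_real (A \<inter> {\<omega> \<in> space M. P \<omega>}) \<omega> \<partial>M)"
    unfolding set_lebesgue_integral_def by (simp add: indicator_inter_arith)
  also have "\<dots> = prob (A \<inter> {\<omega> \<in> space M. P \<omega>})"
    by simp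
  finally show ?thesis .
qed

text \<open>A lower bound on \<open>P (A \<inter> B)\<close> for all \<open>A\<close> in the \<open>\<sigma>\<close>-algebra passes to the conditional probability
  of \<open>B\<close>, by testing it on the event where that conditional probability is below \<open>p\<close>.\<close>

lemma (in prob_space) cprob_ge:
  assumes F: "subalgebra M F" and A0: "A0 \<in> sets F" and B: "Measurable.pred M P"
    and le: "\<And>A. A \<in> sets F \<Longrightarrow> A \<subseteq> A0 \<Longrightarrow> p * prob A \<le> prob (A \<inter> {\<omega> \<in> space M. P \<omega>})"
  shows "AE \<omega> in M. \<omega> \<in> A0 \<longrightarrow> p \<le> cprob M F P \<omega>"
proof -
  interpret sigma_finite_subalgebra M F by (rule sigma_finite_subalgebraI[OF F])
  have cF [measurable]: "cprob M F P \<in> borel_measurable F"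
    unfolding cprob_def by simp
  have cM [measurable]: "cprob M F P \<in> borel_measurable M"
    using measurable_from_subalg[OF F cF] .
  have [measurable]: "{\<omega> \<in> space M. P \<omega>} \<in> sets M" using B by auto
  have int: "integrable M (cprob M F P)"
    unfolding cprob_def by (intro real_cond_exp_int integrable_indicat) fact
  \<comment> \<open>The bad event; integrating \<open>p - cprob\<close> over it shows that it is null.\<close>
  define A where "A = {\<omega> \<in> space F. \<omega> \<in> A0 \<and> cprob M F P \<omega> < p}"
  have AF: "A \<in> sets F" unfolding A_def using A0 by measurable
  then have [measurable]: "A \<in> sets M" using F by (auto simp: subalgebra_def)
  have "p * prob A \<le> (\<integral>\<omega>\<in>A. cprob M F P \<omega> \<partial>M)"
    using le[OF AF] by (subst set_integral_cprob[OF F AF B]) (auto simp: A_def)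
  also have "\<dots> = (\<integral>\<omega>. indicator A \<omega> * cprob M F P \<omega> \<partial>M)"
    by (simp add: set_lebesgue_integral_def)
  finally have le_int: "p * prob A \<le> (\<integral>\<omega>. indicator A \<omega> * cprob M F P \<omega> \<partial>M)" .
  have intA: "integrable M (\<lambda>\<omega>. indicator A \<omega> * cprob M F P \<omega>)"
    using integrable_mult_indicator[OF \<open>A \<in> sets M\<close> int] by simp
  have "(\<integral>\<omega>. indicator A \<omega> * (p - cprob M F P \<omega>) \<partial>M) = p * prob A - (\<integral>\<omega>. indicator A \<omega> * cprob M F P \<omega> \<partial>M)"
    unfolding right_diff_distrib
    by (subst Bochner_Integration.integral_diff[OF _ intA])
       (auto intro!: integrable_mult_left integrable_indicat simp: \<open>A \<in> sets M\<close> mult.commute[of _ p])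
  then have "(\<integral>\<omega>. indicator A \<omega> * (p - cprob M F P \<omega>) \<partial>M) \<le> 0"
    using le_int by simp
  moreover have nn: "AE \<omega> in M. 0 \<le> indicator A \<omega> * (p - cprob M F P \<omega>)"
    by (auto simp: A_def indicator_def)
  moreover have int': "integrable M (\<lambda>\<omega>. indicator A \<omega> * (p - cprob M F P \<omega>))"
    using int by (intro integrable_mult_indicator[where 'b=real, simplified]) auto
  ultimately have "(\<integral>\<omega>. indicator A \<omega> * (p - cprob M F P \<omega>) \<partial>M) = 0"
    using integral_nonneg_AE[OF nn] by linarith
  then have "AE \<omega> in M. indicator A \<omega> * (p - cprob M F P \<omega>) = 0"
    using integral_nonneg_eq_0_iff_AE[OF int' nn] by simp
  then show ?thesis
  proof (eventually_elim, intro impI)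
    fix \<omega> assume "indicator A \<omega> * (p - cprob M F P \<omega>) = 0" "\<omega> \<in> A0"
    moreover have "\<omega> \<in> space F" using A0 \<open>\<omega> \<in> A0\<close> sets.sets_into_space by auto
    ultimately show "p \<le> cprob M F P \<omega>"
      by (cases "cprob M F P \<omega> < p") (auto simp: A_def)
  qed
qed

text \<open>The reference rule is given conditionally on \<open>hist_delay\<close>, the drift is needed conditionally on the
  smaller \<open>hist\<close>.\<close>

lemma (in prob_space) cprob_ge_tower:
  assumes G: "subalgebra M G" and F: "subalgebra G F" and A0: "A0 \<in> sets F" and P: "Measurable.pred M P"
    and le: "AE \<omega> in M. \<omega> \<in> A0 \<longrightarrow> p \<le> cprob M G P \<omega>"
  shows "AE \<omega> in M. \<omega> \<in> A0 \<longrightarrow> p \<le> cprob M F P \<omega>"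
proof -
  have MF: "subalgebra M F" using G F by (auto simp: subalgebra_def)
  interpret sigma_finite_subalgebra M G by (rule sigma_finite_subalgebraI[OF G])
  have ev: "{\<omega> \<in> space M. P \<omega>} \<in> events" using P by auto
  have int: "integrable M (cprob M G P)"
    unfolding cprob_def by (intro real_cond_exp_int integrable_indicat ev)
  show ?thesis
  proof (rule cprob_ge[OF MF A0 P])
    fix A assume A: "A \<in> sets F" "A \<subseteq> A0"
    then have AG: "A \<in> sets G" and AM: "A \<in> sets M" using F MF by (auto simp: subalgebra_def)
    have "p * prob A = (\<integral>\<omega>. p * indicator A \<omega> \<partial>M)"
      using AM by simp
    also have "\<dots> \<le> (\<integral>\<omega>. indicator A \<omega> * cprob M G P \<omega> \<partial>M)"
    proof (rule integral_mono_AE)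
      show "AE \<omega> in M. p * indicator A \<omega> \<le> indicator A \<omega> * cprob M G P \<omega>"
        using le by eventually_elim (use A in \<open>auto simp: indicator_def\<close>)
      show "integrable M (\<lambda>\<omega>. indicator A \<omega> * cprob M G P \<omega>)"
        using integrable_mult_indicator[OF AM int] by simp
      show "integrable M (\<lambda>\<omega>. p * indicator A \<omega>)"
        using AM by (intro integrable_mult_right integrable_indicat)
    qed
    also have "\<dots> = prob (A \<inter> {\<omega> \<in> space M. P \<omega>})"
      using set_integral_cprob[OF G AG P] by (simp add: set_lebesgue_integral_def)
    finally show "p * prob A \<le> prob (A \<inter> {\<omega> \<in> space M. P \<omega>})" .
  qed
qed

text \<open>Locality lets a random target set be replaced, on a suitable event, by a fixed one.\<close>

lemma (in prob_space) cprob_local: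
  assumes F: "subalgebra M F" and E: "E \<in> sets F" and P: "Measurable.pred M P" and Q: "Measurable.pred M Q"
    and eq: "AE \<omega> in M. \<omega> \<in> E \<longrightarrow> P \<omega> = Q \<omega>"
  shows "AE \<omega> in M. \<omega> \<in> E \<longrightarrow> cprob M F P \<omega> = cprob M F Q \<omega>"
proof -
  interpret sigma_finite_subalgebra M F by (rule sigma_finite_subalgebraI[OF F])
  have EM: "E \<in> events" using E F by (auto simp: subalgebra_def)
  have ev: "{\<omega> \<in> space M. P \<omega>} \<in> events" "{\<omega> \<in> space M. Q \<omega>} \<in> events" using P Q by auto
  have mult: "AE \<omega> in M. real_cond_exp M F (\<lambda>\<omega>. indicator E \<omega> * indicat_real {\<omega> \<in> space M. R \<omega>} \<omega>) \<omega>
      = indicator E \<omega> * cprob M F R \<omega>" if "{\<omega> \<in> space M. R \<omega>} \<in> events" for R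
    unfolding cprob_def using E that integrable_mult_indicator[OF EM integrable_indicat[OF that]]
    by (intro real_cond_exp_mult) auto
  have "AE \<omega> in M. real_cond_exp M F (\<lambda>\<omega>. indicator E \<omega> * indicat_real {\<omega> \<in> space M. P \<omega>} \<omega>) \<omega> =
      real_cond_exp M F (\<lambda>\<omega>. indicator E \<omega> * indicat_real {\<omega> \<in> space M. Q \<omega>} \<omega>) \<omega>"
  proof (rule real_cond_exp_cong)
    show "AE \<omega> in M. indicator E \<omega> * indicat_real {\<omega> \<in> space M. P \<omega>} \<omega> =
        indicator E \<omega> * indicat_real {\<omega> \<in> space M. Q \<omega>} \<omega>"
      using eq by eventually_elim (auto simp: indicator_def)
  qed (use EM ev in auto)
  with mult[OF ev(1)] mult[OF ev(2)] show ?thesis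
    by eventually_elim (auto simp: indicator_def split: if_splits)
qed

lemma (in prob_space) has_cond_law_AE:
  assumes F: "subalgebra M F" and X: "has_cond_law M F S X Q" and B: "B \<in> sets S"
    and one: "\<And>\<omega>. \<omega> \<in> space M \<Longrightarrow> measure (Q \<omega>) B = 1"
  shows "AE \<omega> in M. X \<omega> \<in> B"
proof -
  have [measurable]: "X \<in> measurable M S" using X by (simp add: has_cond_law_def)
  have P: "Measurable.pred M (\<lambda>\<omega>. X \<omega> \<in> B)" using B by measurable
  have sp: "space M \<in> sets F" using F by (metis sets.top subalgebra_def)
  have "AE \<omega> in M. cprob M F (\<lambda>\<omega>. X \<omega> \<in> B) \<omega> = measure (Q \<omega>) B"
    using X B by (auto simp: has_cond_law_def)
  then have 1: "AE \<omega> in M. cprob M F (\<lambda>\<omega>. X \<omega> \<in> B) \<omega> = 1"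
    using AE_space by eventually_elim (simp add: one)
  have "prob (space M \<inter> {\<omega> \<in> space M. X \<omega> \<in> B}) = (\<integral>\<omega>\<in>space M. cprob M F (\<lambda>\<omega>. X \<omega> \<in> B) \<omega> \<partial>M)"
    by (rule set_integral_cprob[OF F sp P, symmetric])
  also have "\<dots> = (\<integral>\<omega>\<in>space M. 1 \<partial>M)"
  proof (rule set_lebesgue_integral_cong_AE)
    show "cprob M F (\<lambda>\<omega>. X \<omega> \<in> B) \<in> borel_measurable M"
      unfolding cprob_def using borel_measurable_cond_exp2 by auto
  qed (use 1 in auto)
  also have "\<dots> = 1" by (simp add: set_lebesgue_integral_def prob_space)
  finally have "prob {\<omega> \<in> space M. X \<omega> \<in> B} = 1" by (simp add: Int_absorb1)
  then show ?thesis using P by (subst (asm) prob_eq_1) auto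
qed

section \<open>Geometric drift\<close>

text \<open>The graph of a convex function lies below its chord over \<open>[0, b]\<close>.\<close>

lemma exp_chord_bound:
  fixes \<eta> z b :: real
  assumes "0 \<le> z" "z \<le> b" "0 < b"
  shows "exp (- \<eta> * z) \<le> 1 - z / b * (1 - exp (- \<eta> * b))"
proof -
  have "exp ((1 - z / b) *\<^sub>R 0 + (z / b) *\<^sub>R (- \<eta> * b)) \<le> (1 - z / b) * exp 0 + (z / b) * exp (- \<eta> * b)"
    using assms by (intro convex_onD[OF exp_convex]) auto
  then show ?thesis using assms by (simp add: algebra_simps)
qed

text \<open>By the chord bound \<open>exp (\<eta> Y)\<close> is at most \<open>exp (\<eta> (X + c))\<close> times a function that is affine in \<open>Z\<close>,
  so only the conditional mean of the decrease \<open>Z\<close> matters. Large downward jumps of \<open>Y\<close> are harmless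
  because \<open>Z\<close> is only a lower bound for the decrease.\<close>

lemma (in prob_space) exp_drift:
  assumes F: "subalgebra M F" and A: "A \<in> sets F"
    and X: "X \<in> borel_measurable F" and Y: "Y \<in> borel_measurable M"
    and intX: "integrable M (\<lambda>\<omega>. exp (\<eta> * X \<omega>))" and intY: "integrable M (\<lambda>\<omega>. exp (\<eta> * Y \<omega>))"
    and Z: "Z \<in> borel_measurable M" "\<And>\<omega>. 0 \<le> Z \<omega>" "\<And>\<omega>. Z \<omega> \<le> b" and "0 < b" "0 < \<eta>"
    and le: "AE \<omega> in M. \<omega> \<in> A \<longrightarrow> Y \<omega> \<le> X \<omega> + c - Z \<omega>"
    and EZ: "AE \<omega> in M. \<omega> \<in> A \<longrightarrow> p * b \<le> real_cond_exp M F Z \<omega>"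
  shows "AE \<omega> in M. \<omega> \<in> A \<longrightarrow> real_cond_exp M F (\<lambda>\<omega>. exp (\<eta> * Y \<omega>)) \<omega>
      \<le> exp (\<eta> * c) * (1 - p * (1 - exp (- \<eta> * b))) * exp (\<eta> * X \<omega>)"
proof -
  interpret sigma_finite_subalgebra M F by (rule sigma_finite_subalgebraI[OF F])
  \<comment> \<open>The slope of the chord: \<open>exp (- \<eta> z) \<le> 1 - \<theta> z\<close> on \<open>[0, b]\<close>.\<close>
  define \<theta> where "\<theta> = (1 - exp (- \<eta> * b)) / b"
  have \<theta>: "0 \<le> \<theta>" using \<open>0 < b\<close> \<open>0 < \<eta>\<close> by (simp add: \<theta>_def)
  have AM: "A \<in> events" using A F by (auto simp: subalgebra_def)
  have XM [measurable]: "X \<in> borel_measurable M" using measurable_from_subalg[OF F X] .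
  note [measurable] = X Y Z(1) A AM
  let ?f = "\<lambda>\<omega>. indicator A \<omega> * (exp (\<eta> * c) * exp (\<eta> * X \<omega>))"
  let ?g = "\<lambda>\<omega>. 1 - \<theta> * Z \<omega>"
  have intZ: "integrable M Z"
    using Z by (intro integrable_const_bound[of _ b]) (auto simp: abs_le_iff intro!: AE_I2 order_trans[of _ 0])
  have intf: "integrable M ?f"
    using integrable_mult_indicator[OF AM integrable_mult_right[OF intX, of "exp (\<eta> * c)"]] by simp
  have g01: "\<bar>?g \<omega>\<bar> \<le> 1 + \<theta> * b" for \<omega>
  proof -
    have "0 \<le> \<theta> * Z \<omega>" "\<theta> * Z \<omega> \<le> \<theta> * b"
      using Z(2,3)[of \<omega>] \<theta> by (auto intro: mult_left_mono)
    then show ?thesis by linarith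
  qed
  have intfg: "integrable M (\<lambda>\<omega>. ?f \<omega> * ?g \<omega>)"
  proof (rule Bochner_Integration.integrable_bound)
    show "integrable M (\<lambda>\<omega>. ?f \<omega> * (1 + \<theta> * b))" using intf by (intro integrable_mult_left)
    show "AE \<omega> in M. norm (?f \<omega> * ?g \<omega>) \<le> norm (?f \<omega> * (1 + \<theta> * b))"
      using g01 \<theta> \<open>0 < b\<close> by (auto intro!: AE_I2 mult_left_mono simp: abs_mult)
  qed measurable
  have intAY: "integrable M (\<lambda>\<omega>. indicator A \<omega> * exp (\<eta> * Y \<omega>))"
    using integrable_mult_indicator[OF AM intY] by simp
  have "AE \<omega> in M. indicator A \<omega> * exp (\<eta> * Y \<omega>) \<le> ?f \<omega> * ?g \<omega>"
    using le
  proof eventually_elim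
    case (elim \<omega>)
    show ?case
    proof (cases "\<omega> \<in> A")
      case True
      then have "exp (\<eta> * Y \<omega>) \<le> exp (\<eta> * (X \<omega> + c - Z \<omega>))"
        using elim \<open>0 < \<eta>\<close> by simp
      also have "\<dots> = exp (\<eta> * c) * exp (\<eta> * X \<omega>) * exp (- \<eta> * Z \<omega>)"
        by (simp add: exp_add[symmetric] algebra_simps)
      also have "\<dots> \<le> exp (\<eta> * c) * exp (\<eta> * X \<omega>) * ?g \<omega>"
        using exp_chord_bound[OF Z(2,3) \<open>0 < b\<close>, of \<eta>] by (intro mult_left_mono) (auto simp: \<theta>_def mult.commute)
      finally show ?thesis using True by simp
    qed simp
  qed
  then have 1: "AE \<omega> in M. real_cond_exp M F (\<lambda>\<omega>. indicator A \<omega> * exp (\<eta> * Y \<omega>)) \<omega> \<le> real_cond_exp M F (\<lambda>\<omega>. ?f \<omega> * ?g \<omega>) \<omega>"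
    using intfg intAY by (intro real_cond_exp_mono)
  have 2: "AE \<omega> in M. real_cond_exp M F (\<lambda>\<omega>. indicator A \<omega> * exp (\<eta> * Y \<omega>)) \<omega> = indicator A \<omega> * real_cond_exp M F (\<lambda>\<omega>. exp (\<eta> * Y \<omega>)) \<omega>"
    using intAY by (intro real_cond_exp_mult) auto
  have 3: "AE \<omega> in M. real_cond_exp M F (\<lambda>\<omega>. ?f \<omega> * ?g \<omega>) \<omega> = ?f \<omega> * real_cond_exp M F ?g \<omega>"
    using intfg by (intro real_cond_exp_mult) auto
  have 4: "AE \<omega> in M. real_cond_exp M F ?g \<omega> = real_cond_exp M F (\<lambda>_. 1) \<omega> - real_cond_exp M F (\<lambda>\<omega>. \<theta> * Z \<omega>) \<omega>"
    using intZ by (intro real_cond_exp_diff) auto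
  have 5: "AE \<omega> in M. real_cond_exp M F (\<lambda>\<omega>. \<theta> * Z \<omega>) \<omega> = \<theta> * real_cond_exp M F Z \<omega>"
    by (intro real_cond_exp_cmult intZ)
  have 6: "AE \<omega> in M. real_cond_exp M F (\<lambda>_. 1) \<omega> = (1::real)"
    by (intro real_cond_exp_F_meas) auto
  show ?thesis
    using 1 2 3 4 5 6 EZ
  proof (eventually_elim, intro impI)
    fix \<omega>
    let ?c = "exp (\<eta> * c) * exp (\<eta> * X \<omega>)"
    assume h: "real_cond_exp M F (\<lambda>\<omega>. indicator A \<omega> * exp (\<eta> * Y \<omega>)) \<omega> \<le> real_cond_exp M F (\<lambda>\<omega>. ?f \<omega> * ?g \<omega>) \<omega>"
      "real_cond_exp M F (\<lambda>\<omega>. indicator A \<omega> * exp (\<eta> * Y \<omega>)) \<omega> = indicator A \<omega> * real_cond_exp M F (\<lambda>\<omega>. exp (\<eta> * Y \<omega>)) \<omega>"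
      "real_cond_exp M F (\<lambda>\<omega>. ?f \<omega> * ?g \<omega>) \<omega> = ?f \<omega> * real_cond_exp M F ?g \<omega>"
      "real_cond_exp M F ?g \<omega> = real_cond_exp M F (\<lambda>_. 1) \<omega> - real_cond_exp M F (\<lambda>\<omega>. \<theta> * Z \<omega>) \<omega>"
      "real_cond_exp M F (\<lambda>\<omega>. \<theta> * Z \<omega>) \<omega> = \<theta> * real_cond_exp M F Z \<omega>"
      "real_cond_exp M F (\<lambda>_. 1) \<omega> = (1::real)"
      "\<omega> \<in> A \<longrightarrow> p * b \<le> real_cond_exp M F Z \<omega>" "\<omega> \<in> A"
    have "\<theta> * (p * b) \<le> \<theta> * real_cond_exp M F Z \<omega>"
      using h(7,8) \<theta> by (intro mult_left_mono) auto
    then have c_le: "?c * (1 - \<theta> * real_cond_exp M F Z \<omega>) \<le> ?c * (1 - \<theta> * (p * b))"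
      by (intro mult_left_mono) auto
    have "real_cond_exp M F (\<lambda>\<omega>. exp (\<eta> * Y \<omega>)) \<omega> \<le> ?c * (1 - \<theta> * real_cond_exp M F Z \<omega>)"
      using h(1-6) h(8) by simp
    also note c_le
    also have "\<theta> * (p * b) = p * (1 - exp (- \<eta> * b))"
      using \<open>0 < b\<close> by (simp add: \<theta>_def)
    also have "?c * (1 - p * (1 - exp (- \<eta> * b))) = exp (\<eta> * c) * (1 - p * (1 - exp (- \<eta> * b))) * exp (\<eta> * X \<omega>)"
      by (simp only: mult_ac)
    finally show "real_cond_exp M F (\<lambda>\<omega>. exp (\<eta> * Y \<omega>)) \<omega>
      \<le> exp (\<eta> * c) * (1 - p * (1 - exp (- \<eta> * b))) * exp (\<eta> * X \<omega>)" .
  qed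
qed

text \<open>The geometric form of the Foster-Lyapunov argument. The first bound iterates
  \<open>E [W\<^sub>n\<^sub>+\<^sub>1 | F\<^sub>n] \<le> \<rho> W\<^sub>n + C\<close>. For the second, \<open>W\<close> is killed on its first visit to \<open>{W \<le> w}\<close>; the killed
  process contracts at every step, and it is at least \<open>w\<close> as long as no visit has occurred.\<close>

lemma (in prob_space)
  fixes F :: "nat \<Rightarrow> 'a measure" and W :: "nat \<Rightarrow> 'a \<Rightarrow> real" and \<rho> w C :: real and m n :: nat
  assumes sub: "\<And>n. subalgebra M (F n)" and mono: "\<And>m n. m \<le> n \<Longrightarrow> subalgebra (F n) (F m)"
    and W [measurable]: "\<And>n. W n \<in> borel_measurable (F n)"
    and int: "\<And>n. integrable M (W n)"
    and nonneg: "\<And>n \<omega>. \<omega> \<in> space M \<Longrightarrow> 0 \<le> W n \<omega>"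
    and \<rho>: "0 < \<rho>" "\<rho> < 1" and w: "0 < w"
    and drift: "\<And>n. AE \<omega> in M. w < W n \<omega> \<longrightarrow> real_cond_exp M (F n) (W (Suc n)) \<omega> \<le> \<rho> * W n \<omega>"
    and bounded: "\<And>n. AE \<omega> in M. W n \<omega> \<le> w \<longrightarrow> real_cond_exp M (F n) (W (Suc n)) \<omega> \<le> C"
    and C: "0 \<le> C"
  shows geometric_drift_moment: "AE \<omega> in M. real_cond_exp M (F m) (W (m + n)) \<omega>
      \<le> \<rho> ^ n * W m \<omega> + (1 - \<rho> ^ n) / (1 - \<rho>) * C" (is ?moment)
    and geometric_drift_hitting: "AE \<omega> in M. cprob M (F m) (\<lambda>\<omega>. \<forall>j\<le>n. w < W (m + j) \<omega>) \<omega>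
      \<le> W m \<omega> / w * \<rho> ^ n" (is ?hitting)
proof -
  interpret sigma_finite_subalgebra M "F i" for i by (rule sigma_finite_subalgebraI[OF sub])
  have W_M [measurable]: "W n \<in> borel_measurable M" for n
    using measurable_from_subalg[OF sub W] .
  show ?moment
  proof (induction n)
    case 0
    have "AE \<omega> in M. real_cond_exp M (F m) (W m) \<omega> = W m \<omega>"
      by (rule real_cond_exp_F_meas[OF int W])
    then show ?case by eventually_elim simp
  next
    case (Suc n)
    let ?E = "real_cond_exp M (F (m + n)) (W (Suc (m + n)))"
    have intE: "integrable M ?E" using real_cond_exp_int(1)[OF int] .
    have "AE \<omega> in M. ?E \<omega> \<le> \<rho> * W (m + n) \<omega> + C"
      using drift[of "m + n"] bounded[of "m + n"] AE_space
    proof eventually_elim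
      case (elim \<omega>)
      then show ?case
        using \<rho> C nonneg[of \<omega> "m + n"] by (cases "w < W (m + n) \<omega>") (auto intro: add_increasing add_increasing2)
    qed
    then have 1: "AE \<omega> in M. real_cond_exp M (F m) ?E \<omega> \<le> real_cond_exp M (F m) (\<lambda>\<omega>. \<rho> * W (m + n) \<omega> + C) \<omega>"
      using int intE by (intro real_cond_exp_mono) auto
    have 2: "AE \<omega> in M. real_cond_exp M (F m) (\<lambda>\<omega>. \<rho> * W (m + n) \<omega> + C) \<omega> =
        real_cond_exp M (F m) (\<lambda>\<omega>. \<rho> * W (m + n) \<omega>) \<omega> + real_cond_exp M (F m) (\<lambda>_. C) \<omega>"
      using int by (intro real_cond_exp_add) auto
    have 3: "AE \<omega> in M. real_cond_exp M (F m) (\<lambda>\<omega>. \<rho> * W (m + n) \<omega>) \<omega> = \<rho> * real_cond_exp M (F m) (W (m + n)) \<omega>"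
      using int by (intro real_cond_exp_cmult) auto
    have 4: "AE \<omega> in M. real_cond_exp M (F m) (\<lambda>_. C) \<omega> = C"
      by (intro real_cond_exp_F_meas) auto
    have 5: "AE \<omega> in M. real_cond_exp M (F m) ?E \<omega> = real_cond_exp M (F m) (W (Suc (m + n))) \<omega>"
      by (intro real_cond_exp_nested_subalg sub mono int) auto
    have "\<rho> * (a / d * C) + C = (\<rho> * a + d) / d * C" if "d \<noteq> 0" for a d
      using that by (simp add: field_simps)
    from this[of "1 - \<rho>" "1 - \<rho> ^ n"]
    have geom: "\<rho> * ((1 - \<rho> ^ n) / (1 - \<rho>) * C) + C = (1 - \<rho> ^ Suc n) / (1 - \<rho>) * C"
      using \<rho> by (simp add: right_diff_distrib)
    show ?case
      using Suc 1 2 3 4 5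
    proof eventually_elim
      case (elim \<omega>)
      have "real_cond_exp M (F m) (W (m + Suc n)) \<omega> \<le> \<rho> * real_cond_exp M (F m) (W (m + n)) \<omega> + C"
        using elim by simp
      also have "\<dots> \<le> \<rho> * (\<rho> ^ n * W m \<omega> + (1 - \<rho> ^ n) / (1 - \<rho>) * C) + C"
        using elim(1) \<rho> by (intro add_right_mono mult_left_mono) auto
      also have "\<dots> = \<rho> ^ Suc n * W m \<omega> + (1 - \<rho> ^ Suc n) / (1 - \<rho>) * C"
        using geom by (simp only: power_Suc distrib_left mult.assoc add.assoc)
      finally show ?case .
    qed
  qed

  \<comment> \<open>\<open>H n\<close> indicates survival through the times \<open>m, \<dots>, m + n - 1\<close>; leaving out \<open>m + n\<close> makes
    \<open>H (Suc n)\<close> measurable at time \<open>m + n\<close>, just before the step to \<open>m + n + 1\<close>.\<close>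
  define H where "H n \<omega> = (\<Prod>j<n. if w < W (m + j) \<omega> then 1 else 0 :: real)" for n \<omega>
  have H_01: "H n \<omega> \<in> {0, 1}" for n \<omega>
    unfolding H_def by (induction n) auto
  have H_nn: "0 \<le> H n \<omega>" and H_le: "H n \<omega> \<le> 1" for n \<omega>
    using H_01[of n \<omega>] by auto
  have W_le: "W (m + j) \<in> borel_measurable (F (m + n))" if "j \<le> n" for j n
    using measurable_from_subalg[OF mono[of "m + j" "m + n"] W[of "m + j"]] that by simp
  have H_F [measurable]: "H (Suc n) \<in> borel_measurable (F (m + n))" for n
  proof -
    have "(\<lambda>\<omega>. if w < W (m + j) \<omega> then 1 else 0 :: real) \<in> borel_measurable (F (m + n))"
      if "j \<in> {..<Suc n}" for j
    proof -
      have [measurable]: "W (m + j) \<in> borel_measurable (F (m + n))"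
        using W_le that by auto
      show ?thesis by measurable
    qed
    then show ?thesis
      unfolding H_def by (intro borel_measurable_prod)
  qed
  have H_M [measurable]: "H n \<in> borel_measurable M" for n
    unfolding H_def by measurable
  have intH: "integrable M (\<lambda>\<omega>. H n \<omega> * W k \<omega>)" for n k
    by (rule Bochner_Integration.integrable_bound[OF int[of k]])
       (auto intro!: AE_I2 simp: abs_mult mult_left_le_one_le H_nn H_le)
  have killed: "AE \<omega> in M. real_cond_exp M (F m) (\<lambda>\<omega>. H n \<omega> * W (m + n) \<omega>) \<omega> \<le> \<rho> ^ n * W m \<omega>" for n
  proof (induction n)
    case 0
    have "AE \<omega> in M. real_cond_exp M (F m) (W m) \<omega> = W m \<omega>"
      by (rule real_cond_exp_F_meas[OF int W])
    then show ?case by eventually_elim (simp add: H_def)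
  next
    case (Suc n)
    let ?E = "real_cond_exp M (F (m + n)) (W (Suc (m + n)))"
    let ?H = "\<lambda>\<omega>. H (Suc n) \<omega> * W (Suc (m + n)) \<omega>"
    have 1: "AE \<omega> in M. real_cond_exp M (F (m + n)) ?H \<omega> = H (Suc n) \<omega> * ?E \<omega>"
      using intH[of "Suc n" "Suc (m + n)"] by (intro real_cond_exp_mult) auto
    have 2: "AE \<omega> in M. real_cond_exp M (F (m + n)) ?H \<omega> \<le> \<rho> * (H n \<omega> * W (m + n) \<omega>)"
      using 1 drift[of "m + n"] AE_space
    proof eventually_elim
      case (elim \<omega>)
      have "H (Suc n) \<omega> = (if w < W (m + n) \<omega> then H n \<omega> else 0)"
        by (simp add: H_def)
      then show ?case
        using elim H_nn[of n \<omega>] mult_left_mono[of "?E \<omega>" "\<rho> * W (m + n) \<omega>" "H n \<omega>"] \<rho> w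
          nonneg[of \<omega> "m + n"]
        by (auto simp: mult_ac)
    qed
    have 3: "AE \<omega> in M. real_cond_exp M (F m) (real_cond_exp M (F (m + n)) ?H) \<omega>
        \<le> real_cond_exp M (F m) (\<lambda>\<omega>. \<rho> * (H n \<omega> * W (m + n) \<omega>)) \<omega>"
      using 2 intH by (intro real_cond_exp_mono real_cond_exp_int) auto
    have 4: "AE \<omega> in M. real_cond_exp M (F m) (real_cond_exp M (F (m + n)) ?H) \<omega> = real_cond_exp M (F m) ?H \<omega>"
      by (intro real_cond_exp_nested_subalg sub mono intH) auto
    have 5: "AE \<omega> in M. real_cond_exp M (F m) (\<lambda>\<omega>. \<rho> * (H n \<omega> * W (m + n) \<omega>)) \<omega>
        = \<rho> * real_cond_exp M (F m) (\<lambda>\<omega>. H n \<omega> * W (m + n) \<omega>) \<omega>"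
      by (intro real_cond_exp_cmult intH)
    show ?case
      using Suc 3 4 5
    proof eventually_elim
      case (elim \<omega>)
      then have "real_cond_exp M (F m) ?H \<omega> \<le> \<rho> * real_cond_exp M (F m) (\<lambda>\<omega>. H n \<omega> * W (m + n) \<omega>) \<omega>"
        by simp
      also have "\<dots> \<le> \<rho> * (\<rho> ^ n * W m \<omega>)"
        using elim(1) \<rho> by (intro mult_left_mono) auto
      finally show ?case by simp
    qed
  qed
  let ?B = "{\<omega> \<in> space M. \<forall>j\<le>n. w < W (m + j) \<omega>}"
  have B [measurable]: "?B \<in> sets M" by measurable
  have "AE \<omega> in M. indicat_real ?B \<omega> \<le> 1 / w * (H n \<omega> * W (m + n) \<omega>)"
  proof (rule AE_I2)
    fix \<omega> assume "\<omega> \<in> space M"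
    then show "indicat_real ?B \<omega> \<le> 1 / w * (H n \<omega> * W (m + n) \<omega>)"
      using w H_nn[of n \<omega>] nonneg[of \<omega> "m + n"]
      by (auto simp: indicator_def H_def)
  qed
  then have 1: "AE \<omega> in M. real_cond_exp M (F m) (indicat_real ?B) \<omega> \<le>
      real_cond_exp M (F m) (\<lambda>\<omega>. 1 / w * (H n \<omega> * W (m + n) \<omega>)) \<omega>"
    using intH by (intro real_cond_exp_mono integrable_indicat B) auto
  have 2: "AE \<omega> in M. real_cond_exp M (F m) (\<lambda>\<omega>. 1 / w * (H n \<omega> * W (m + n) \<omega>)) \<omega>
     = 1 / w * real_cond_exp M (F m) (\<lambda>\<omega>. H n \<omega> * W (m + n) \<omega>) \<omega>"
    by (intro real_cond_exp_cmult intH)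
  show ?hitting
    unfolding cprob_def using 1 2 killed[of n]
  proof eventually_elim
    case (elim \<omega>)
    have "1 / w * real_cond_exp M (F m) (\<lambda>\<omega>. H n \<omega> * W (m + n) \<omega>) \<omega> \<le> 1 / w * (\<rho> ^ n * W m \<omega>)"
      using elim(3) w by (intro mult_left_mono) auto
    then show ?case using elim(1,2) by (simp add: mult_ac)
  qed
qed

lemma (in prob_space) cond_markov:
  assumes F: "subalgebra M F" and W: "integrable M W" "\<And>\<omega>. \<omega> \<in> space M \<Longrightarrow> 0 \<le> W \<omega>"
    and P: "Measurable.pred M P" and c: "0 < c" and le: "AE \<omega> in M. P \<omega> \<longrightarrow> c \<le> W \<omega>"
    and bound: "AE \<omega> in M. real_cond_exp M F W \<omega> \<le> b \<omega>"
  shows "AE \<omega> in M. cprob M F P \<omega> \<le> b \<omega> / c"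
proof -
  interpret sigma_finite_subalgebra M F by (rule sigma_finite_subalgebraI[OF F])
  have "AE \<omega> in M. indicat_real {\<omega> \<in> space M. P \<omega>} \<omega> \<le> 1 / c * W \<omega>"
    using le AE_space by eventually_elim (use c W(2) in \<open>auto simp: indicator_def field_simps\<close>)
  then have 1: "AE \<omega> in M. cprob M F P \<omega> \<le> real_cond_exp M F (\<lambda>\<omega>. 1 / c * W \<omega>) \<omega>"
    unfolding cprob_def using W(1) P by (intro real_cond_exp_mono integrable_indicat) auto
  have 2: "AE \<omega> in M. real_cond_exp M F (\<lambda>\<omega>. 1 / c * W \<omega>) \<omega> = 1 / c * real_cond_exp M F W \<omega>"
    by (intro real_cond_exp_cmult W(1))
  show ?thesis
    using 1 2 bound
  proof eventually_elim
    case (elim \<omega>)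
    have "1 / c * real_cond_exp M F W \<omega> \<le> 1 / c * b \<omega>"
      using elim(3) c by (intro mult_left_mono) auto
    then show ?case using elim(1,2) by simp
  qed
qed

text \<open>At \<open>\<eta> = 0\<close> the contraction factor equals \<open>1\<close> and has derivative \<open>c - p b < 0\<close>.\<close>

lemma exp_contraction_rate:
  fixes c p b :: real
  assumes "0 < b" "0 \<le> p" "p \<le> 1" "c < p * b"
  shows "eventually (\<lambda>\<eta>. exp (\<eta> * c) * (1 - p * (1 - exp (- \<eta> * b))) < 1) (at_right 0)"
proof -
  let ?f = "\<lambda>\<eta>. exp (\<eta> * c) * (1 - p * (1 - exp (- \<eta> * b)))"
  have "(?f has_real_derivative (c - p * b)) (at 0)"
    by (auto intro!: derivative_eq_intros)
  from DERIV_neg_dec_right[OF this] assms(4) obtain d where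
    "d > 0" "\<And>h. h > 0 \<Longrightarrow> h < d \<Longrightarrow> ?f h < ?f 0"
    by auto
  then show ?thesis
    unfolding eventually_at_right_field by (intro exI[of _ d]) auto
qed

section \<open>The filtration of the model\<close>

lemma subalgebra_generated:
  assumes "X \<in> measurable G S" "space G = space M"
  shows "subalgebra G (generated M S X)"
proof -
  have X: "X \<in> space M \<rightarrow> space S"
    using measurable_space[OF assms(1)] by (simp add: assms(2))
  have "X -` B \<inter> space M \<in> sets G" if "B \<in> sets S" for B
    using measurable_sets[OF assms(1) that] by (simp only: assms(2))
  then have "sets (generated M S X) \<subseteq> sets G"
    unfolding sets_vimage_algebra2[OF X] by blast
  then show ?thesis
    by (simp add: subalgebra_def assms(2))
qed

lemma measurable_generated: "X \<in> measurable M S \<Longrightarrow> X \<in> measurable (generated M S X) S"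
  by (rule measurable_vimage_algebra1) (auto dest: measurable_space)

lemma measurable_block_of_past:
  fixes \<xi> :: "('w, 'v::finite) blocks"
  assumes G: "past \<xi> n \<in> measurable G (past_space n)" and m: "m \<in> {1..n}"
  shows "\<xi> m \<in> measurable G block_space"
proof -
  have "(\<lambda>\<omega>. past \<xi> n \<omega> m) \<in> measurable G block_space"
    by (rule measurable_compose[OF G measurable_component_singleton[OF m]])
  moreover have "(\<lambda>\<omega>. past \<xi> n \<omega> m) = \<xi> m"
    using m by (auto simp: past_def)
  ultimately show ?thesis by simp
qed

lemma measurable_block_coordinates:
  fixes \<xi> :: "('w, 'v::finite) blocks"
  assumes [measurable]: "\<xi> m \<in> measurable G block_space"
  shows "m \<ge> 1 \<Longrightarrow> issue_time \<xi> m \<in> borel_measurable G"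
    and "blockID \<xi> m \<in> borel_measurable G"
    and "Ref \<xi> m \<in> measurable G (list_space borel)"
    and "nodeID \<xi> m \<in> measurable G (count_space UNIV)"
    and "(\<lambda>\<omega>. delay \<xi> m \<omega> i) \<in> borel_measurable G"
proof -
  show "issue_time \<xi> m \<in> borel_measurable G" if "m \<ge> 1"
    using that unfolding issue_time_def[abs_def] by simp
  show "blockID \<xi> m \<in> borel_measurable G"
    unfolding blockID_def[abs_def] by measurable
  show "Ref \<xi> m \<in> measurable G (list_space borel)"
    unfolding Ref_def[abs_def] by measurable
  show "nodeID \<xi> m \<in> measurable G (count_space UNIV)"
    unfolding nodeID_def[abs_def] by measurable
  have "delay \<xi> m \<in> measurable G delay_space"
    unfolding delay_def[abs_def] by measurable
  from measurable_compose[OF this measurable_component_singleton[of i]]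
  show "(\<lambda>\<omega>. delay \<xi> m \<omega> i) \<in> borel_measurable G" by simp
qed

lemma measurable_X_obs:
  fixes \<xi> :: "('w, 'v::finite) blocks"
  assumes "past \<xi> n \<in> measurable G (past_space n)"
  shows "(\<lambda>\<omega>. real (X_obs \<xi> n \<omega>)) \<in> borel_measurable G"
  unfolding X_obs_def pool_obs_def
  using measurable_block_coordinates(2,3)[OF measurable_block_of_past[OF assms]]
  by (intro measurable_card_tips) auto

lemma measurable_L:
  fixes \<xi> :: "('w, 'v::finite) blocks"
  assumes "past \<xi> n \<in> measurable G (past_space n)"
  shows "(\<lambda>\<omega>. real (L \<xi> \<Delta> n \<omega>)) \<in> borel_measurable G"
proof -
  have L_eq: "real (L \<xi> \<Delta> n \<omega>) =
      (\<Sum>m\<in>{1..n}. if issue_time \<xi> m \<omega> \<in> {issue_time \<xi> n \<omega> - \<Delta> <.. issue_time \<xi> n \<omega>} then 1 else 0)" for \<omega>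
  proof -
    have "real (L \<xi> \<Delta> n \<omega>) = (\<Sum>m\<in>{m \<in> {1..n}. issue_time \<xi> m \<omega> \<in> {issue_time \<xi> n \<omega> - \<Delta> <.. issue_time \<xi> n \<omega>}}. 1)"
      by (simp add: L_def)
    then show ?thesis by (subst (asm) sum.inter_filter) auto
  qed
  show ?thesis
    unfolding L_eq
  proof (rule borel_measurable_sum)
    fix m assume m: "m \<in> {1..n}"
    then have n: "n \<in> {1..n}" by simp
    have [measurable]: "issue_time \<xi> m \<in> borel_measurable G" "issue_time \<xi> n \<in> borel_measurable G"
      using measurable_block_coordinates(1)[OF measurable_block_of_past[OF assms]] m n by auto
    show "(\<lambda>\<omega>. if issue_time \<xi> m \<omega> \<in> {issue_time \<xi> n \<omega> - \<Delta> <.. issue_time \<xi> n \<omega>} then 1 else 0 :: real)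
        \<in> borel_measurable G"
      unfolding greaterThanAtMost_iff by measurable
  qed
qed

context block_model
begin

lemma measurable_gap: "(\<lambda>\<omega>. issue_time \<xi> (Suc n) \<omega> - issue_time \<xi> n \<omega>) \<in> borel_measurable M"
  using poisson unfolding poisson_arrivals_def distributed_def by auto

lemma measurable_issue_time: "issue_time \<xi> n \<in> borel_measurable M"
proof (induction n)
  case 0
  then show ?case by (simp add: issue_time_def[abs_def])
next
  case (Suc n)
  from borel_measurable_add[OF measurable_gap[of n] Suc] show ?case by simp
qed

lemma measurable_delay: "n \<ge> 1 \<Longrightarrow> delay \<xi> n \<in> measurable M delay_space"
  using delay_law[of n] by (simp add: has_cond_law_def)

lemma measurable_Ref: "n \<ge> 1 \<Longrightarrow> Ref \<xi> n \<in> measurable M (list_space borel)"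
  using Ref_law[of n] by (simp add: has_cond_law_def)

lemma measurable_blockID: "n \<ge> 1 \<Longrightarrow> blockID \<xi> n \<in> borel_measurable M"
  using blockID_indep by (auto simp: indep_vars_def)

lemma measurable_nodeID: "n \<ge> 1 \<Longrightarrow> nodeID \<xi> n \<in> measurable M (count_space UNIV)"
  using nodeID_indep by (auto simp: indep_vars_def)

lemma measurable_block: "n \<ge> 1 \<Longrightarrow> \<xi> n \<in> measurable M block_space"
proof -
  assume n: "n \<ge> 1"
  note [measurable] = measurable_issue_time measurable_delay[OF n] measurable_Ref[OF n]
    measurable_blockID[OF n] measurable_nodeID[OF n]
  have "\<xi> n = (\<lambda>\<omega>. (issue_time \<xi> n \<omega>, blockID \<xi> n \<omega>, Ref \<xi> n \<omega>, nodeID \<xi> n \<omega>, delay \<xi> n \<omega>))"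
    using n by (auto simp: issue_time_def blockID_def Ref_def nodeID_def delay_def)
  also have "\<dots> \<in> measurable M block_space" by measurable
  finally show ?thesis .
qed

lemma measurable_past: "past \<xi> n \<in> measurable M (past_space n)"
  unfolding past_def[abs_def] by (rule measurable_restrict) (auto intro: measurable_block)

lemma past_hist: "past \<xi> n \<in> measurable (hist M \<xi> n) (past_space n)"
  unfolding hist_def by (rule measurable_generated[OF measurable_past])

lemma space_hist [simp]: "space (hist M \<xi> n) = space M"
  by (simp add: hist_def)

lemma subalgebra_hist: "subalgebra M (hist M \<xi> n)"
  unfolding hist_def by (rule subalgebra_generated[OF measurable_past]) simp

text \<open>Stated for an arbitrary \<open>\<sigma>\<close>-algebra because both \<open>hist\<close> and \<open>hist_delay\<close> make the past measurable.\<close>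

lemma past_mono:
  assumes "past \<xi> n \<in> measurable G (past_space n)" "m \<le> n"
  shows "past \<xi> m \<in> measurable G (past_space m)"
  unfolding past_def[of \<xi> m, abs_def]
  using assms(2) by (intro measurable_restrict measurable_block_of_past[OF assms(1)]) auto

lemma subalgebra_hist_mono: "m \<le> n \<Longrightarrow> subalgebra (hist M \<xi> n) (hist M \<xi> m)"
  unfolding hist_def[of M \<xi> m]
  by (rule subalgebra_generated[OF past_mono[OF past_hist]]) auto

lemma measurable_hist_issue_data:
  "(\<lambda>\<omega>. (past \<xi> n \<omega>, issue_time \<xi> (Suc n) \<omega>, blockID \<xi> (Suc n) \<omega>, nodeID \<xi> (Suc n) \<omega>))
    \<in> measurable M (past_space n \<Otimes>\<^sub>M borel \<Otimes>\<^sub>M borel \<Otimes>\<^sub>M count_space UNIV)"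
  using measurable_past measurable_issue_time measurable_blockID[of "Suc n"] measurable_nodeID[of "Suc n"]
  by (intro measurable_Pair) auto

lemma measurable_hist_delay_data:
  "(\<lambda>\<omega>. (past \<xi> n \<omega>, issue_time \<xi> (Suc n) \<omega>, blockID \<xi> (Suc n) \<omega>, nodeID \<xi> (Suc n) \<omega>, delay \<xi> (Suc n) \<omega>))
    \<in> measurable M (past_space n \<Otimes>\<^sub>M borel \<Otimes>\<^sub>M borel \<Otimes>\<^sub>M count_space UNIV \<Otimes>\<^sub>M delay_space)"
  using measurable_past measurable_issue_time measurable_blockID[of "Suc n"] measurable_nodeID[of "Suc n"]
    measurable_delay[of "Suc n"]
  by (intro measurable_Pair) auto

lemma subalgebra_hist_issue: "subalgebra M (hist_issue M \<xi> (Suc n))"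
  unfolding hist_issue_def diff_Suc_1 by (rule subalgebra_generated[OF measurable_hist_issue_data refl])

lemma subalgebra_hist_delay: "subalgebra M (hist_delay M \<xi> (Suc n))"
  unfolding hist_delay_def diff_Suc_1 by (rule subalgebra_generated[OF measurable_hist_delay_data refl])

lemma space_hist_delay [simp]: "space (hist_delay M \<xi> n) = space M"
  by (simp add: hist_delay_def)

lemma
  shows past_hist_delay: "past \<xi> n \<in> measurable (hist_delay M \<xi> (Suc n)) (past_space n)"
    and issue_time_hist_delay: "issue_time \<xi> (Suc n) \<in> borel_measurable (hist_delay M \<xi> (Suc n))"
    and nodeID_hist_delay: "nodeID \<xi> (Suc n) \<in> measurable (hist_delay M \<xi> (Suc n)) (count_space UNIV)"
proof -
  have *: "(\<lambda>\<omega>. (past \<xi> n \<omega>, issue_time \<xi> (Suc n) \<omega>, blockID \<xi> (Suc n) \<omega>, nodeID \<xi> (Suc n) \<omega>, delay \<xi> (Suc n) \<omega>))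
    \<in> measurable (hist_delay M \<xi> (Suc n)) (past_space n \<Otimes>\<^sub>M borel \<Otimes>\<^sub>M borel \<Otimes>\<^sub>M count_space UNIV \<Otimes>\<^sub>M delay_space)"
    unfolding hist_delay_def diff_Suc_1 by (rule measurable_generated[OF measurable_hist_delay_data])
  from measurable_compose[OF * measurable_fst]
  show "past \<xi> n \<in> measurable (hist_delay M \<xi> (Suc n)) (past_space n)" by (simp only: fst_conv snd_conv)
  note snd1 = measurable_compose[OF * measurable_snd]
  from measurable_compose[OF snd1 measurable_fst]
  show "issue_time \<xi> (Suc n) \<in> borel_measurable (hist_delay M \<xi> (Suc n))" by (simp only: fst_conv snd_conv)
  note snd2 = measurable_compose[OF snd1 measurable_snd]
  note snd3 = measurable_compose[OF snd2 measurable_snd]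
  from measurable_compose[OF snd3 measurable_fst]
  show "nodeID \<xi> (Suc n) \<in> measurable (hist_delay M \<xi> (Suc n)) (count_space UNIV)" by (simp only: fst_conv snd_conv)
qed

lemma subalgebra_hist_delay_hist: "subalgebra (hist_delay M \<xi> (Suc n)) (hist M \<xi> n)"
  unfolding hist_def by (rule subalgebra_generated[OF past_hist_delay]) simp

lemma measurable_V: "V \<xi> \<Delta> \<alpha> n \<in> borel_measurable (hist M \<xi> n)"
  unfolding V_def[abs_def] using measurable_X_obs[OF past_hist] measurable_L[OF past_hist] by simp

lemma measurable_V_M [measurable]: "V \<xi> \<Delta> \<alpha> n \<in> borel_measurable M"
  using measurable_from_subalg[OF subalgebra_hist measurable_V] .

lemma measurable_X_loc: "(\<lambda>\<omega>. real (X_loc \<xi> i n \<omega>)) \<in> borel_measurable M"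
proof -
  have block: "\<xi> m \<in> measurable M block_space" if "m \<in> {1..n}" for m
    using that measurable_block by auto
  note coord = measurable_block_coordinates[where \<xi> = \<xi>, OF block]
  show ?thesis
    unfolding X_loc_def pool_def
  proof (rule measurable_card_tips)
    fix m assume m: "m \<in> {1..n}"
    have [measurable]: "issue_time \<xi> m \<in> borel_measurable M" "issue_time \<xi> n \<in> borel_measurable M"
      "(\<lambda>\<omega>. delay \<xi> m \<omega> i) \<in> borel_measurable M"
      using coord(5)[OF m] measurable_issue_time by auto
    have "Measurable.pred M (\<lambda>\<omega>. issue_time \<xi> m \<omega> + delay \<xi> m \<omega> i \<le> issue_time \<xi> n \<omega>)"
      by measurable
    with m show "Measurable.pred M (\<lambda>\<omega>. m \<in> {m. 1 \<le> m \<and> m \<le> n \<and> issue_time \<xi> m \<omega> + delay \<xi> m \<omega> i \<le> issue_time \<xi> n \<omega>})"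
      by simp
    show "blockID \<xi> m \<in> borel_measurable M" "Ref \<xi> m \<in> measurable M (list_space borel)"
      using coord(2,3)[OF m] by auto
  qed auto
qed

section \<open>Almost sure properties of the paths\<close>

lemma prob_gap_gt:
  assumes "a \<ge> 0"
  shows "prob {\<omega> \<in> space M. a < issue_time \<xi> (Suc n) \<omega> - issue_time \<xi> n \<omega>} = exp (- rate * a)"
proof -
  have "distributed M lborel (\<lambda>\<omega>. issue_time \<xi> (Suc n) \<omega> - issue_time \<xi> n \<omega>) (exponential_density rate)"
    using poisson by (simp add: poisson_arrivals_def)
  from exponential_distributedD_gt[OF this assms] rate_pos show ?thesis by (simp add: mult.commute)
qed

lemma AE_issue_time_mono: "AE \<omega> in M. \<forall>m n. m \<le> n \<longrightarrow> issue_time \<xi> m \<omega> \<le> issue_time \<xi> n \<omega>"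
proof -
  have "AE \<omega> in M. issue_time \<xi> n \<omega> \<le> issue_time \<xi> (Suc n) \<omega>" for n
  proof -
    have "AE \<omega> in M. 0 < issue_time \<xi> (Suc n) \<omega> - issue_time \<xi> n \<omega>"
      using prob_gap_gt[of 0 n] measurable_issue_time[of n] measurable_issue_time[of "Suc n"] by (intro prob_Collect_eq_1[THEN iffD1]) auto
    then show ?thesis by eventually_elim simp
  qed
  then have "AE \<omega> in M. \<forall>n. issue_time \<xi> n \<omega> \<le> issue_time \<xi> (Suc n) \<omega>"
    by (simp add: AE_all_countable)
  then show ?thesis
    by eventually_elim (auto intro: lift_Suc_mono_le)
qed

lemma AE_delay_le: "AE \<omega> in M. \<forall>n i. 1 \<le> n \<longrightarrow> delay \<xi> n \<omega> i \<le> \<Delta>"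
proof -
  let ?B = "{d \<in> space (delay_space :: ('v \<Rightarrow> real) measure). \<forall>i. d i \<le> \<Delta>}"
  have B: "?B \<in> sets delay_space" by measurable
  have "AE \<omega> in M. delay \<xi> (Suc n) \<omega> \<in> ?B" for n
  proof (rule has_cond_law_AE[OF subalgebra_hist_issue delay_law B])
    fix \<omega>
    interpret D: prob_space "D (nodeID \<xi> (Suc n) \<omega>)" by (rule D_prob)
    have "AE d in D (nodeID \<xi> (Suc n) \<omega>). \<forall>i. d i \<le> \<Delta>"
      using partial_synchrony by (simp add: AE_all_countable)
    then have "AE d in D (nodeID \<xi> (Suc n) \<omega>). d \<in> ?B"
      by eventually_elim (simp add: space_PiM)
    then show "measure (D (nodeID \<xi> (Suc n) \<omega>)) ?B = 1"
      using B by (intro D.prob_eq_1[THEN iffD2]) (auto simp: D_sets)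
  qed auto
  then have "AE \<omega> in M. \<forall>n. delay \<xi> (Suc n) \<omega> \<in> ?B" by (simp add: AE_all_countable)
  then show ?thesis
  proof (eventually_elim, intro allI impI)
    fix \<omega> n i assume "\<forall>n. delay \<xi> (Suc n) \<omega> \<in> ?B" "1 \<le> (n::nat)"
    then show "delay \<xi> n \<omega> i \<le> \<Delta>" by (cases n) auto
  qed
qed

lemma finite_pool_pre: "finite (pool_pre \<xi> n i \<omega>)"
  unfolding pool_pre_def by (rule finite_tips[of _ n]) auto

lemma AE_Ref_distinct_bounded:
  "AE \<omega> in M. \<forall>n. 1 \<le> n \<longrightarrow> distinct (Ref \<xi> n \<omega>) \<and> length (Ref \<xi> n \<omega>) \<le> k"
proof -
  let ?B = "{xs :: real list. distinct xs \<and> length xs \<le> k}"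
  have "AE \<omega> in M. Ref \<xi> (Suc n) \<omega> \<in> ?B" for n
    by (rule has_cond_law_AE[OF subalgebra_hist_delay Ref_law distinct_bounded_in_list_space])
       (auto simp: Let_def intro!: prob_sample_distinct_bounded finite_pool_pre)
  then have "AE \<omega> in M. \<forall>n. Ref \<xi> (Suc n) \<omega> \<in> ?B" by (simp add: AE_all_countable)
  then show ?thesis
  proof (eventually_elim, intro allI impI)
    fix \<omega> n assume "\<forall>n. Ref \<xi> (Suc n) \<omega> \<in> ?B" "1 \<le> (n::nat)"
    then show "distinct (Ref \<xi> n \<omega>) \<and> length (Ref \<xi> n \<omega>) \<le> k" by (cases n) auto
  qed
qed

text \<open>The almost sure event on which all comparisons of pools hold path by path.\<close>

definition regular :: "'w \<Rightarrow> bool" where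
  "regular \<omega> \<longleftrightarrow> (\<forall>m n. m \<le> n \<longrightarrow> issue_time \<xi> m \<omega> \<le> issue_time \<xi> n \<omega>) \<and>
     (\<forall>n i. 1 \<le> n \<longrightarrow> delay \<xi> n \<omega> i \<le> \<Delta>) \<and>
     (\<forall>n. 1 \<le> n \<longrightarrow> distinct (Ref \<xi> n \<omega>) \<and> length (Ref \<xi> n \<omega>) \<le> k)"

lemma AE_regular: "AE \<omega> in M. regular \<omega>"
  using AE_issue_time_mono AE_delay_le AE_Ref_distinct_bounded
  by eventually_elim (simp add: regular_def)

text \<open>A block still under way at time \<open>s \<ge> t\<^sub>n\<close> was issued less than \<open>\<Delta>\<close> before \<open>s\<close>, hence within the window
  that \<open>L\<^sub>n\<close> counts.\<close>

lemma card_hidden_le: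
  assumes "regular \<omega>" "issue_time \<xi> n \<omega> \<le> s"
  shows "card ({1..n} - {m. 1 \<le> m \<and> m \<le> n \<and> issue_time \<xi> m \<omega> + delay \<xi> m \<omega> i \<le> s}) \<le> L \<xi> \<Delta> n \<omega>"
  unfolding L_def
proof (rule card_mono)
  show "{1..n} - {m. 1 \<le> m \<and> m \<le> n \<and> issue_time \<xi> m \<omega> + delay \<xi> m \<omega> i \<le> s} \<subseteq>
      {m \<in> {1..n}. issue_time \<xi> m \<omega> \<in> {issue_time \<xi> n \<omega> - \<Delta> <.. issue_time \<xi> n \<omega>}}"
  proof
    fix m assume m: "m \<in> {1..n} - {m. 1 \<le> m \<and> m \<le> n \<and> issue_time \<xi> m \<omega> + delay \<xi> m \<omega> i \<le> s}"
    then have "delay \<xi> m \<omega> i \<le> \<Delta>" "issue_time \<xi> m \<omega> \<le> issue_time \<xi> n \<omega>"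
      using assms(1) by (auto simp: regular_def)
    then show "m \<in> {m \<in> {1..n}. issue_time \<xi> m \<omega> \<in> {issue_time \<xi> n \<omega> - \<Delta> <.. issue_time \<xi> n \<omega>}}"
      using m assms(2) by auto
  qed
qed simp

text \<open>Everything in a local pool is an observer tip or is referenced by one of at most \<open>L\<^sub>n\<close> hidden
  blocks.\<close>

lemma X_loc_le:
  assumes "regular \<omega>"
  shows "X_loc \<xi> i n \<omega> \<le> X_obs \<xi> n \<omega> + k * L \<xi> \<Delta> n \<omega>"
proof -
  let ?I = "{m. 1 \<le> m \<and> m \<le> n \<and> issue_time \<xi> m \<omega> + delay \<xi> m \<omega> i \<le> issue_time \<xi> n \<omega>}"
  have fin: "finite (tips \<xi> {1..n} \<omega>)" by (rule finite_tips[of _ n]) simp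
  have fin': "finite (tips \<xi> ?I \<omega>)" by (rule finite_tips[of _ n]) auto
  have "card (tips \<xi> ?I \<omega>) \<le> card (tips \<xi> {1..n} \<omega> \<union> (tips \<xi> ?I \<omega> - tips \<xi> {1..n} \<omega>))"
    using fin fin' by (intro card_mono) auto
  also have "\<dots> \<le> card (tips \<xi> {1..n} \<omega>) + card (tips \<xi> ?I \<omega> - tips \<xi> {1..n} \<omega>)"
    by (rule card_Un_le)
  also have "card (tips \<xi> ?I \<omega> - tips \<xi> {1..n} \<omega>) \<le> k * card ({1..n} - ?I)"
    using assms by (intro card_tips_diff_le(2)) (auto simp: regular_def)
  also have "\<dots> \<le> k * L \<xi> \<Delta> n \<omega>"
    by (intro mult_left_mono card_hidden_le assms) auto
  finally show ?thesis
    by (simp add: X_loc_def X_obs_def pool_def pool_obs_def)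
qed

text \<open>Here \<open>Suc n\<close> is the block about to be issued: its pool is compared with the observer pool after
  \<open>n\<close> blocks, and hidden blocks are counted by \<open>L\<^sub>n\<close> although time has moved on to \<open>t\<^sub>n\<^sub>+\<^sub>1\<close>.\<close>

lemma pool_pre_estimates:
  assumes "regular \<omega>"
  shows "X_obs \<xi> n \<omega> \<le> card (pool_pre \<xi> (Suc n) i \<omega> \<inter> pool_obs \<xi> n \<omega>) + L \<xi> \<Delta> n \<omega>"
    and "card (pool_pre \<xi> (Suc n) i \<omega>) \<le> card (pool_pre \<xi> (Suc n) i \<omega> \<inter> pool_obs \<xi> n \<omega>) + k * L \<xi> \<Delta> n \<omega>"
proof -
  let ?I = "{m. 1 \<le> m \<and> m \<le> n \<and> issue_time \<xi> m \<omega> + delay \<xi> m \<omega> i \<le> issue_time \<xi> (Suc n) \<omega>}"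
  let ?O = "tips \<xi> {1..n} \<omega>" and ?P = "tips \<xi> ?I \<omega>"
  have P: "pool_pre \<xi> (Suc n) i \<omega> = ?P" by (simp add: pool_pre_def less_Suc_eq_le)
  have fin: "finite ?O" "finite ?P" by (rule finite_tips[of _ n]; auto)+
  have hid: "card ({1..n} - ?I) \<le> L \<xi> \<Delta> n \<omega>"
    using assms by (intro card_hidden_le) (auto simp: regular_def)
  have "card (?O - ?P) \<le> card ({1..n} - ?I)"
    using assms by (intro card_tips_diff_le(1)[of _ _ _ _ k]) (auto simp: regular_def)
  then show "X_obs \<xi> n \<omega> \<le> card (pool_pre \<xi> (Suc n) i \<omega> \<inter> pool_obs \<xi> n \<omega>) + L \<xi> \<Delta> n \<omega>"
    unfolding X_obs_def pool_obs_def P using hid card_Int_Diff[OF fin(1), of ?P] by (simp add: Int_commute)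
  have "card (?P - ?O) \<le> k * card ({1..n} - ?I)"
    using assms by (intro card_tips_diff_le(2)) (auto simp: regular_def)
  also have "\<dots> \<le> k * L \<xi> \<Delta> n \<omega>" using hid by simp
  finally show "card (pool_pre \<xi> (Suc n) i \<omega>) \<le> card (pool_pre \<xi> (Suc n) i \<omega> \<inter> pool_obs \<xi> n \<omega>) + k * L \<xi> \<Delta> n \<omega>"
    unfolding pool_obs_def P using card_Int_Diff[OF fin(2), of ?O] by simp
qed

lemma L_Suc_le:
  assumes "regular \<omega>"
  shows "L \<xi> \<Delta> (Suc n) \<omega> \<le> L \<xi> \<Delta> n \<omega> + 1"
    and "\<Delta> \<le> issue_time \<xi> (Suc n) \<omega> - issue_time \<xi> n \<omega> \<Longrightarrow> L \<xi> \<Delta> (Suc n) \<omega> \<le> 1"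
proof -
  let ?A = "\<lambda>n. {m \<in> {1..n}. issue_time \<xi> m \<omega> \<in> {issue_time \<xi> n \<omega> - \<Delta> <.. issue_time \<xi> n \<omega>}}"
  have mono: "issue_time \<xi> m \<omega> \<le> issue_time \<xi> n \<omega>" if "m \<le> n" for m n
    using assms that by (simp add: regular_def)
  have "?A (Suc n) \<subseteq> insert (Suc n) (?A n)"
    using mono[of n "Suc n"] by (auto simp: le_Suc_eq intro: mono)
  then have "card (?A (Suc n)) \<le> card (insert (Suc n) (?A n))" by (intro card_mono) auto
  also have "\<dots> \<le> card (?A n) + 1" by (simp add: card_insert_if)
  finally show "L \<xi> \<Delta> (Suc n) \<omega> \<le> L \<xi> \<Delta> n \<omega> + 1" by (simp add: L_def)
  show "L \<xi> \<Delta> (Suc n) \<omega> \<le> 1" if "\<Delta> \<le> issue_time \<xi> (Suc n) \<omega> - issue_time \<xi> n \<omega>"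
  proof -
    have "?A (Suc n) \<subseteq> {Suc n}"
    proof
      fix m assume m: "m \<in> ?A (Suc n)"
      show "m \<in> {Suc n}"
      proof (rule ccontr)
        assume "m \<notin> {Suc n}"
        then have "m \<le> n" using m by auto
        from mono[OF this] show False using m that by auto
      qed
    qed
    then have "card (?A (Suc n)) \<le> card {Suc n}" by (intro card_mono) auto
    then show ?thesis by (simp add: L_def)
  qed
qed

lemma X_obs_Suc_le:
  "X_obs \<xi> (Suc n) \<omega> + card (pool_obs \<xi> n \<omega> \<inter> set (Ref \<xi> (Suc n) \<omega>)) \<le> X_obs \<xi> n \<omega> + 1"
  using card_tips_Suc_le[of \<xi> n \<omega>] by (simp add: X_obs_def pool_obs_def)

lemma X_obs_le: "X_obs \<xi> n \<omega> \<le> Suc n"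
proof -
  have "X_obs \<xi> n \<omega> \<le> card ((\<lambda>m. ident \<xi> m \<omega>) ` {..n})"
    unfolding X_obs_def pool_obs_def by (intro card_mono tips_subset_ident) auto
  also have "\<dots> \<le> card {..n}" by (rule card_image_le) simp
  finally show ?thesis by simp
qed

lemma L_le: "L \<xi> \<Delta> n \<omega> \<le> n"
proof -
  have "L \<xi> \<Delta> n \<omega> \<le> card {1..n}" unfolding L_def by (intro card_mono) auto
  then show ?thesis by simp
qed

end

section \<open>The conditional law of the next block\<close>

text \<open>The finite unions of sets from a countable basis: around each point of \<open>T\<close> there is a basis set
  that avoids the finite set \<open>S - T\<close>.\<close>

lemma countable_family_separating_finite_sets:
  "\<exists>\<U> :: real set set. countable \<U> \<and> \<U> \<subseteq> sets borel \<and>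
    (\<forall>S T. finite S \<longrightarrow> (\<exists>U\<in>\<U>. S \<inter> U = S \<inter> T))"
proof -
  obtain B :: "real set set" where B: "countable B" "topological_basis B"
    using ex_countable_basis by auto
  let ?\<U> = "Union ` {b. finite b \<and> b \<subseteq> B}"
  have "\<exists>U\<in>?\<U>. S \<inter> U = S \<inter> T" if S: "finite S" for S T
  proof -
    have op: "open (- (S - T))" using S by (intro open_Compl finite_imp_closed) auto
    have "\<exists>b\<in>B. t \<in> b \<and> b \<subseteq> - (S - T)" if "t \<in> S \<inter> T" for t
    proof -
      have "t \<in> - (S - T)" using that by auto
      from topological_basisE[OF B(2) op this] show ?thesis by metis
    qed
    then obtain b where b: "\<And>t. t \<in> S \<inter> T \<Longrightarrow> b t \<in> B \<and> t \<in> b t \<and> b t \<subseteq> - (S - T)"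
      by metis
    have "S \<inter> \<Union> (b ` (S \<inter> T)) = S \<inter> T"
    proof (intro equalityI subsetI)
      fix x assume "x \<in> S \<inter> \<Union> (b ` (S \<inter> T))"
      then obtain t where "t \<in> S \<inter> T" "x \<in> b t" "x \<in> S" by auto
      then show "x \<in> S \<inter> T" using b[of t] by auto
    qed (use b in auto)
    moreover have "b ` (S \<inter> T) \<in> {b. finite b \<and> b \<subseteq> B}" using b S by auto
    ultimately show ?thesis by (meson imageI)
  qed
  moreover have "countable ?\<U>" using B(1) by (intro countable_image countable_Collect_finite_subset)
  moreover have "?\<U> \<subseteq> sets borel"
    using topological_basis_open[OF B(2)] by (auto intro!: borel_open open_Union)
  ultimately show ?thesis by (intro exI[of _ ?\<U>] conjI allI impI)
qed

context block_model
begin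

text \<open>The gap is independent of the history and exponentially distributed.\<close>

lemma cprob_gap_ge:
  "AE \<omega> in M. exp (- rate * \<Delta>) \<le> cprob M (hist M \<xi> n) (\<lambda>\<omega>. \<Delta> < issue_time \<xi> (Suc n) \<omega> - issue_time \<xi> n \<omega>) \<omega>"
proof -
  let ?P = "\<lambda>\<omega>. \<Delta> < issue_time \<xi> (Suc n) \<omega> - issue_time \<xi> n \<omega>"
  let ?X = "\<lambda>\<omega>. (issue_time \<xi> (Suc n) \<omega> - issue_time \<xi> n \<omega>, blockID \<xi> (Suc n) \<omega>, nodeID \<xi> (Suc n) \<omega>)"
  let ?S = "borel \<Otimes>\<^sub>M borel \<Otimes>\<^sub>M count_space UNIV :: (real \<times> real \<times> 'v) measure"
  have P: "Measurable.pred M ?P" using measurable_gap[of n] by measurable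
  have "?X -` ({\<Delta><..} \<times> UNIV) \<inter> space M \<in> sets (generated M ?S ?X)"
  proof (rule in_vimage_algebra)
    have "{\<Delta><..} \<times> space (borel \<Otimes>\<^sub>M count_space UNIV :: (real \<times> 'v) measure) \<in> sets ?S"
      by (intro pair_measureI) auto
    then show "{\<Delta><..} \<times> UNIV \<in> sets ?S" by (simp add: space_pair_measure)
  qed
  moreover have "?X -` ({\<Delta><..} \<times> UNIV) \<inter> space M = {\<omega> \<in> space M. ?P \<omega>}" by auto
  ultimately have ev: "{\<omega> \<in> space M. ?P \<omega>} \<in> sets (generated M ?S ?X)" by simp
  have "AE \<omega> in M. \<omega> \<in> space M \<longrightarrow> exp (- rate * \<Delta>) \<le> cprob M (hist M \<xi> n) ?P \<omega>"
  proof (rule cprob_ge[OF subalgebra_hist _ P])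
    show "space M \<in> sets (hist M \<xi> n)" by (metis sets.top space_hist)
    fix A assume A: "A \<in> sets (hist M \<xi> n)"
    have "prob ({\<omega> \<in> space M. ?P \<omega>} \<inter> A) = prob {\<omega> \<in> space M. ?P \<omega>} * prob A"
      by (rule indep_setD[OF innovation_indep ev A])
    then show "exp (- rate * \<Delta>) * prob A \<le> prob (A \<inter> {\<omega> \<in> space M. ?P \<omega>})"
      using prob_gap_gt[OF Delta_nonneg, of n] by (simp add: Int_commute)
  qed
  then show ?thesis using AE_space by eventually_elim simp
qed

lemma pred_Ref_nth_in_obs:
  "Measurable.pred M (\<lambda>\<omega>. j < length (Ref \<xi> (Suc n) \<omega>) \<and> Ref \<xi> (Suc n) \<omega> ! j \<in> pool_obs \<xi> n \<omega>)"
proof -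
  have [measurable]: "Ref \<xi> (Suc n) \<in> measurable M (list_space borel)" by (rule measurable_Ref) simp
  have "Measurable.pred M (\<lambda>\<omega>. entry (Ref \<xi> (Suc n) \<omega>) j \<in> tips \<xi> {1..n} \<omega>)"
    by (rule pred_member_tips[of _ n]) (auto intro: measurable_blockID measurable_Ref)
  then have [measurable]: "Measurable.pred M (\<lambda>\<omega>. entry (Ref \<xi> (Suc n) \<omega>) j \<in> pool_obs \<xi> n \<omega>)"
    by (simp add: pool_obs_def)
  have "Measurable.pred M (\<lambda>\<omega>. j < length (Ref \<xi> (Suc n) \<omega>) \<and> entry (Ref \<xi> (Suc n) \<omega>) j \<in> pool_obs \<xi> n \<omega>)"
    by measurable
  also have "(\<lambda>\<omega>. j < length (Ref \<xi> (Suc n) \<omega>) \<and> entry (Ref \<xi> (Suc n) \<omega>) j \<in> pool_obs \<xi> n \<omega>) =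
     (\<lambda>\<omega>. j < length (Ref \<xi> (Suc n) \<omega>) \<and> Ref \<xi> (Suc n) \<omega> ! j \<in> pool_obs \<xi> n \<omega>)"
    by (intro ext conj_cong) (auto simp: entry_def)
  finally show ?thesis .
qed

text \<open>Let \<open>P\<close> be the issuer's pool and \<open>O\<close> the observer pool. On the event that a fixed Borel set \<open>U\<close>
  satisfies \<open>P \<inter> U = P \<inter> O\<close>, the \<open>j\<close>-th reference lies in \<open>O\<close> exactly if it lies in \<open>U\<close>, and the latter
  has conditional probability \<open>|P \<inter> O| / |P|\<close>. Countably many \<open>U\<close> cover all cases because \<open>P\<close> is
  finite. Only \<open>j < 2\<close> is considered, since a pool of two elements guarantees just two references.\<close>

lemma cprob_Ref_nth_in_obs_ge:
  fixes p :: real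
  assumes A0: "A0 \<in> sets (hist M \<xi> n)" and j: "j < 2"
    and frac: "AE \<omega> in M. \<omega> \<in> A0 \<longrightarrow> (\<forall>i. 2 \<le> card (pool_pre \<xi> (Suc n) i \<omega>) \<and>
      p * card (pool_pre \<xi> (Suc n) i \<omega>) \<le> card (pool_pre \<xi> (Suc n) i \<omega> \<inter> pool_obs \<xi> n \<omega>))"
  shows "AE \<omega> in M. \<omega> \<in> A0 \<longrightarrow> p \<le> cprob M (hist M \<xi> n)
    (\<lambda>\<omega>. j < length (Ref \<xi> (Suc n) \<omega>) \<and> Ref \<xi> (Suc n) \<omega> ! j \<in> pool_obs \<xi> n \<omega>) \<omega>"
proof (rule cprob_ge_tower[OF subalgebra_hist_delay subalgebra_hist_delay_hist A0 pred_Ref_nth_in_obs])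
  let ?G = "hist_delay M \<xi> (Suc n)"
  define P where "P \<omega> = pool_pre \<xi> (Suc n) (nodeID \<xi> (Suc n) \<omega>) \<omega>" for \<omega>
  define O' where "O' = pool_obs \<xi> n"
  define R where "R = Ref \<xi> (Suc n)"
  define B where "B U = {xs :: real list. j < length xs \<and> xs ! j \<in> U}" for U
  define I where "I \<omega> = {m. 1 \<le> m \<and> m < Suc n \<and>
      issue_time \<xi> m \<omega> + delay \<xi> m \<omega> (nodeID \<xi> (Suc n) \<omega>) \<le> issue_time \<xi> (Suc n) \<omega>}" for \<omega>
  have P_tips: "P \<omega> = tips \<xi> (I \<omega>) \<omega>" for \<omega> by (simp add: P_def pool_pre_def I_def)
  have O_tips: "O' \<omega> = tips \<xi> {1..n} \<omega>" for \<omega> by (simp add: O'_def pool_obs_def)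
  have finP: "finite (P \<omega>)" for \<omega> unfolding P_def by (rule finite_pool_pre)
  have I_sub: "I \<omega> \<subseteq> {1..n}" for \<omega> by (auto simp: I_def)
  have R_M: "R \<in> measurable M (list_space borel)" unfolding R_def by (rule measurable_Ref) simp
  have B_sets: "B U \<in> sets (list_space borel)" if "U \<in> sets borel" for U
    unfolding B_def by (rule nth_in_list_space[OF that])
  have pred_B: "Measurable.pred M (\<lambda>\<omega>. R \<omega> \<in> B U)" if "U \<in> sets borel" for U
    by (rule pred_sets2[OF B_sets[OF that] R_M])

  note coord = measurable_block_coordinates[where \<xi> = \<xi>, OF measurable_block_of_past[OF past_hist_delay]]
  have pred_I: "Measurable.pred ?G (\<lambda>\<omega>. m \<in> I \<omega>)" if m: "m \<in> {1..n}" for m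
  proof -
    have "(\<lambda>\<omega>. delay \<xi> m \<omega> (nodeID \<xi> (Suc n) \<omega>)) \<in> borel_measurable ?G"
      by (rule measurable_compose_countable[OF coord(5)[OF m] nodeID_hist_delay])
    moreover have "issue_time \<xi> m \<in> borel_measurable ?G" using coord(1)[OF m] m by simp
    ultimately have "Measurable.pred ?G (\<lambda>\<omega>. issue_time \<xi> m \<omega> + delay \<xi> m \<omega> (nodeID \<xi> (Suc n) \<omega>) \<le> issue_time \<xi> (Suc n) \<omega>)"
      using issue_time_hist_delay[of n] by measurable
    then show ?thesis using m by (simp add: I_def)
  qed
  have ident: "ident \<xi> m \<in> borel_measurable ?G" if "m \<in> {..n}" for m
    using coord(2)[of m] that by (cases "m = 0") (auto simp: ident_def[abs_def])
  have card_P: "(\<lambda>\<omega>. real (card (P \<omega>))) \<in> borel_measurable ?G"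
    unfolding P_tips by (rule measurable_card_tips[OF I_sub pred_I coord(2,3)])
  \<comment> \<open>The event \<open>{|P| \<ge> 2, P \<inter> U = P \<inter> T}\<close>, written through the enumeration of candidates so that
    its measurability is visible.\<close>
  define E where "E U T = {\<omega> \<in> space ?G. 2 \<le> real (card (P \<omega>)) \<and> (\<forall>m\<in>{..n}. ident \<xi> m \<omega> \<in> P \<omega> \<longrightarrow>
      (ident \<xi> m \<omega> \<in> U \<longleftrightarrow> ident \<xi> m \<omega> \<in> T \<omega>))}" for U and T :: "'w \<Rightarrow> real set"
  have E_iff: "\<omega> \<in> E U T \<longleftrightarrow> \<omega> \<in> space M \<and> 2 \<le> card (P \<omega>) \<and> P \<omega> \<inter> U = P \<omega> \<inter> T \<omega>" for \<omega> U T
    using tips_subset_ident[OF I_sub, of \<xi> \<omega> \<omega>] unfolding E_def P_tips[symmetric] by auto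
  have E_G: "E U T \<in> sets ?G"
    if U: "U \<in> sets borel" and T: "\<And>m. m \<in> {..n} \<Longrightarrow> Measurable.pred ?G (\<lambda>\<omega>. ident \<xi> m \<omega> \<in> T \<omega>)" for U T
  proof -
    have "Measurable.pred ?G (\<lambda>\<omega>. ident \<xi> m \<omega> \<in> P \<omega> \<longrightarrow> (ident \<xi> m \<omega> \<in> U \<longleftrightarrow> ident \<xi> m \<omega> \<in> T \<omega>))"
      if m: "m \<in> {..n}" for m
    proof -
      have [measurable]: "Measurable.pred ?G (\<lambda>\<omega>. ident \<xi> m \<omega> \<in> P \<omega>)"
        unfolding P_tips by (rule pred_member_tips[OF I_sub pred_I coord(2,3) ident[OF m]])
      note [measurable] = T[OF m] ident[OF m] U
      show ?thesis by measurable
    qed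
    then have [measurable]: "Measurable.pred ?G (\<lambda>\<omega>. \<forall>m\<in>{..n}. ident \<xi> m \<omega> \<in> P \<omega> \<longrightarrow> (ident \<xi> m \<omega> \<in> U \<longleftrightarrow> ident \<xi> m \<omega> \<in> T \<omega>))"
      by (intro pred_intros_finite) auto
    note [measurable] = card_P
    show ?thesis unfolding E_def by measurable
  qed
  have E_O: "E U O' \<in> sets ?G" if "U \<in> sets borel" for U
    by (rule E_G[OF that]) (auto simp: O_tips intro!: pred_member_tips[of _ n] coord(2,3) ident)
  have E_0: "E U (\<lambda>_. {}) \<in> sets ?G" if "U \<in> sets borel" for U
    by (rule E_G[OF that]) auto

  have law: "AE \<omega> in M. 2 \<le> card (P \<omega>) \<longrightarrow> cprob M ?G (\<lambda>\<omega>. R \<omega> \<in> B U) \<omega> = card (P \<omega> \<inter> U) / card (P \<omega>)"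
    if "U \<in> sets borel" for U
  proof -
    have "AE \<omega> in M. cprob M ?G (\<lambda>\<omega>. R \<omega> \<in> B U) \<omega> =
        measure (measure_pmf (pmf_of_set (samples (min k (card (P \<omega>))) (P \<omega>)))) (B U)"
      using Ref_law[of "Suc n"] B_sets[OF that] by (simp add: has_cond_law_def Let_def P_def R_def)
    then show ?thesis
    proof eventually_elim
      case (elim \<omega>)
      then show ?case
        using prob_sample_nth[OF finP, of "min k (card (P \<omega>))" \<omega> j U] j k_ge_2 by (auto simp: B_def)
    qed
  qed

  obtain \<U> :: "real set set" where "countable \<U> \<and> \<U> \<subseteq> sets borel \<and> (\<forall>S T. finite S \<longrightarrow> (\<exists>U\<in>\<U>. S \<inter> U = S \<inter> T))"
    using countable_family_separating_finite_sets by (rule exE)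
  then have cU: "countable \<U>" and borU: "\<U> \<subseteq> sets borel"
    and sep: "\<forall>S T. finite S \<longrightarrow> (\<exists>U\<in>\<U>. S \<inter> U = S \<inter> T)"
    by simp_all

  \<comment> \<open>A reference outside \<open>P\<close> would lie in some \<open>U\<close> of the family that misses \<open>P\<close>, which has
    conditional probability \<open>0\<close>.\<close>
  have in_P: "AE \<omega> in M. 2 \<le> card (P \<omega>) \<longrightarrow> j < length (R \<omega>) \<longrightarrow> R \<omega> ! j \<in> P \<omega>"
  proof -
    have "AE \<omega> in M. \<omega> \<in> E U (\<lambda>_. {}) \<longrightarrow> R \<omega> \<notin> B U" if U: "U \<in> \<U>" for U
    proof -
      note bor = subsetD[OF borU U]
      have E_M: "E U (\<lambda>_. {}) \<in> events"
        using E_0[OF bor] subalgebra_hist_delay[of n] by (auto simp: subalgebra_def)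
      have "prob (E U (\<lambda>_. {}) \<inter> {\<omega> \<in> space M. R \<omega> \<in> B U}) = (\<integral>\<omega>\<in>E U (\<lambda>_. {}). cprob M ?G (\<lambda>\<omega>. R \<omega> \<in> B U) \<omega> \<partial>M)"
        by (rule set_integral_cprob[OF subalgebra_hist_delay E_0[OF bor] pred_B[OF bor], symmetric])
      also have "\<dots> = (\<integral>\<omega>. 0 \<partial>M)"
        unfolding set_lebesgue_integral_def
      proof (rule integral_cong_AE)
        show "AE \<omega> in M. indicator (E U (\<lambda>_. {})) \<omega> *\<^sub>R cprob M ?G (\<lambda>\<omega>. R \<omega> \<in> B U) \<omega> = 0"
          using law[OF bor] by eventually_elim (auto simp: indicator_def E_iff)
        show "(\<lambda>\<omega>. indicator (E U (\<lambda>_. {})) \<omega> *\<^sub>R cprob M ?G (\<lambda>\<omega>. R \<omega> \<in> B U) \<omega>) \<in> borel_measurable M"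
          unfolding cprob_def using E_M by (intro borel_measurable_scaleR borel_measurable_indicator borel_measurable_cond_exp2)
      qed simp
      finally have "prob (E U (\<lambda>_. {}) \<inter> {\<omega> \<in> space M. R \<omega> \<in> B U}) = 0" by simp
      moreover have "E U (\<lambda>_. {}) \<inter> {\<omega> \<in> space M. R \<omega> \<in> B U} \<in> events"
        using E_M pred_B[OF bor] by auto
      ultimately have "AE \<omega> in M. \<omega> \<notin> E U (\<lambda>_. {}) \<inter> {\<omega> \<in> space M. R \<omega> \<in> B U}"
        using prob_eq_0 by blast
      then show ?thesis using AE_space by eventually_elim auto
    qed
    then have "AE \<omega> in M. \<forall>U\<in>\<U>. \<omega> \<in> E U (\<lambda>_. {}) \<longrightarrow> R \<omega> \<notin> B U"
      using cU by (simp add: AE_ball_countable)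
    then show ?thesis
      using AE_space
    proof (eventually_elim, intro impI)
      fix \<omega> assume *: "\<forall>U\<in>\<U>. \<omega> \<in> E U (\<lambda>_. {}) \<longrightarrow> R \<omega> \<notin> B U" "\<omega> \<in> space M"
        "2 \<le> card (P \<omega>)" "j < length (R \<omega>)"
      show "R \<omega> ! j \<in> P \<omega>"
      proof (rule ccontr)
        assume nin: "R \<omega> ! j \<notin> P \<omega>"
        obtain U where U: "U \<in> \<U>" "insert (R \<omega> ! j) (P \<omega>) \<inter> U = insert (R \<omega> ! j) (P \<omega>) \<inter> {R \<omega> ! j}"
          using sep[rule_format, of "insert (R \<omega> ! j) (P \<omega>)" "{R \<omega> ! j}"] finP by auto
        have "x = R \<omega> ! j" if "x \<in> P \<omega>" "x \<in> U" for x
        proof -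
          have "x \<in> insert (R \<omega> ! j) (P \<omega>) \<inter> U" using that by simp
          then show ?thesis unfolding U(2) by simp
        qed
        then have "P \<omega> \<inter> U = {}" using nin by auto
        moreover have "R \<omega> ! j \<in> U" using U(2) by blast
        ultimately have "\<omega> \<in> E U (\<lambda>_. {})" "R \<omega> \<in> B U" using * by (auto simp: E_iff B_def)
        then show False using * U(1) by auto
      qed
    qed
  qed

  have on_E: "AE \<omega> in M. \<omega> \<in> E U O' \<longrightarrow> cprob M ?G (\<lambda>\<omega>. j < length (R \<omega>) \<and> R \<omega> ! j \<in> O' \<omega>) \<omega> =
      card (P \<omega> \<inter> O' \<omega>) / card (P \<omega>)" if U: "U \<in> \<U>" for U
  proof -
    note bor = subsetD[OF borU U]
    have "AE \<omega> in M. \<omega> \<in> E U O' \<longrightarrow> (j < length (R \<omega>) \<and> R \<omega> ! j \<in> O' \<omega>) = (R \<omega> \<in> B U)"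
      using in_P by eventually_elim (auto simp: E_iff B_def)
    then have "AE \<omega> in M. \<omega> \<in> E U O' \<longrightarrow> cprob M ?G (\<lambda>\<omega>. j < length (R \<omega>) \<and> R \<omega> ! j \<in> O' \<omega>) \<omega>
        = cprob M ?G (\<lambda>\<omega>. R \<omega> \<in> B U) \<omega>"
      using pred_Ref_nth_in_obs[of j n]
      by (intro cprob_local subalgebra_hist_delay E_O bor pred_B) (auto simp: R_def O'_def)
    then show ?thesis
      using law[OF bor] by eventually_elim (auto simp: E_iff)
  qed
  then have "AE \<omega> in M. \<forall>U\<in>\<U>. \<omega> \<in> E U O' \<longrightarrow> cprob M ?G (\<lambda>\<omega>. j < length (R \<omega>) \<and> R \<omega> ! j \<in> O' \<omega>) \<omega> =
      card (P \<omega> \<inter> O' \<omega>) / card (P \<omega>)"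
    by (intro AE_ball_countable[THEN iffD2, OF cU] ballI)
  then have "AE \<omega> in M. \<omega> \<in> A0 \<longrightarrow> p \<le> cprob M ?G (\<lambda>\<omega>. j < length (R \<omega>) \<and> R \<omega> ! j \<in> O' \<omega>) \<omega>"
    using frac AE_space
  proof (eventually_elim, intro impI)
    fix \<omega> assume *: "\<forall>U\<in>\<U>. \<omega> \<in> E U O' \<longrightarrow> cprob M ?G (\<lambda>\<omega>. j < length (R \<omega>) \<and> R \<omega> ! j \<in> O' \<omega>) \<omega> =
      card (P \<omega> \<inter> O' \<omega>) / card (P \<omega>)"
      "\<omega> \<in> A0 \<longrightarrow> (\<forall>i. 2 \<le> card (pool_pre \<xi> (Suc n) i \<omega>) \<and>
      p * card (pool_pre \<xi> (Suc n) i \<omega>) \<le> card (pool_pre \<xi> (Suc n) i \<omega> \<inter> pool_obs \<xi> n \<omega>))"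
      "\<omega> \<in> space M" "\<omega> \<in> A0"
    then have P: "2 \<le> card (P \<omega>)" "p * card (P \<omega>) \<le> card (P \<omega> \<inter> O' \<omega>)"
      by (auto simp: P_def O'_def)
    obtain U where U: "U \<in> \<U>" "P \<omega> \<inter> U = P \<omega> \<inter> O' \<omega>"
      using sep[rule_format, OF finP] by blast
    then have "\<omega> \<in> E U O'" using * P by (simp add: E_iff)
    then have "cprob M ?G (\<lambda>\<omega>. j < length (R \<omega>) \<and> R \<omega> ! j \<in> O' \<omega>) \<omega> = card (P \<omega> \<inter> O' \<omega>) / card (P \<omega>)"
      using * U(1) by auto
    moreover have "p \<le> card (P \<omega> \<inter> O' \<omega>) / card (P \<omega>)"
      using P by (subst pos_le_divide_eq) auto
    ultimately show "p \<le> cprob M ?G (\<lambda>\<omega>. j < length (R \<omega>) \<and> R \<omega> ! j \<in> O' \<omega>) \<omega>" by simp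
  qed
  then show "AE \<omega> in M. \<omega> \<in> A0 \<longrightarrow> p \<le> cprob M ?G
     (\<lambda>\<omega>. j < length (Ref \<xi> (Suc n) \<omega>) \<and> Ref \<xi> (Suc n) \<omega> ! j \<in> pool_obs \<xi> n \<omega>) \<omega>"
    by (simp add: R_def O'_def)
qed

end

section \<open>One step of the exponential functional\<close>

context block_model
begin

lemma integrable_exp_V:
  assumes "0 < \<eta>" "0 < \<alpha>"
  shows "integrable M (\<lambda>\<omega>. exp (\<eta> * V \<xi> \<Delta> \<alpha> n \<omega>))"
proof (rule integrable_const_bound[of _ "exp (\<eta> * (real (Suc n) + \<alpha> * real n))"])
  have "V \<xi> \<Delta> \<alpha> n \<omega> \<le> real (Suc n) + \<alpha> * real n" for \<omega>
    unfolding V_def using X_obs_le[of n \<omega>] L_le[of n \<omega>] assms by (intro add_mono mult_left_mono) auto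
  then show "AE \<omega> in M. norm (exp (\<eta> * V \<xi> \<Delta> \<alpha> n \<omega>)) \<le> exp (\<eta> * (real (Suc n) + \<alpha> * real n))"
    using assms by (intro AE_I2) (simp del: of_nat_Suc)
qed measurable

text \<open>\<open>1\<close> for the new tip and \<open>\<alpha>\<close> for the new block in the window, minus the observer tips that
  the new block covers.\<close>

lemma V_Suc_le:
  assumes "regular \<omega>" "0 < \<alpha>"
  shows "V \<xi> \<Delta> \<alpha> (Suc n) \<omega> + card (pool_obs \<xi> n \<omega> \<inter> set (Ref \<xi> (Suc n) \<omega>)) \<le> V \<xi> \<Delta> \<alpha> n \<omega> + (1 + \<alpha>)"
proof -
  have "\<alpha> * real (L \<xi> \<Delta> (Suc n) \<omega>) \<le> \<alpha> * real (L \<xi> \<Delta> n \<omega> + 1)"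
    using L_Suc_le(1)[OF assms(1), of n] assms(2) by (intro mult_left_mono) auto
  moreover have "real (X_obs \<xi> (Suc n) \<omega>) + card (pool_obs \<xi> n \<omega> \<inter> set (Ref \<xi> (Suc n) \<omega>)) \<le> real (X_obs \<xi> n \<omega>) + 1"
    using X_obs_Suc_le[of n \<omega>] by linarith
  ultimately show ?thesis by (simp add: V_def algebra_simps)
qed

text \<open>The case \<open>Z = 0\<close> of \<open>exp_drift\<close>; it controls the step from states with \<open>V \<le> K\<close>.\<close>

lemma growth_bound:
  assumes "0 < \<eta>" "0 < \<alpha>"
  shows "AE \<omega> in M. real_cond_exp M (hist M \<xi> n) (\<lambda>\<omega>. exp (\<eta> * V \<xi> \<Delta> \<alpha> (Suc n) \<omega>)) \<omega>
     \<le> exp (\<eta> * (1 + \<alpha>)) * exp (\<eta> * V \<xi> \<Delta> \<alpha> n \<omega>)"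
proof -
  interpret sigma_finite_subalgebra M "hist M \<xi> n" by (rule sigma_finite_subalgebraI[OF subalgebra_hist])
  have "AE \<omega> in M. \<omega> \<in> space M \<longrightarrow> real_cond_exp M (hist M \<xi> n) (\<lambda>\<omega>. exp (\<eta> * V \<xi> \<Delta> \<alpha> (Suc n) \<omega>)) \<omega>
     \<le> exp (\<eta> * (1 + \<alpha>)) * (1 - 0 * (1 - exp (- \<eta> * 1))) * exp (\<eta> * V \<xi> \<Delta> \<alpha> n \<omega>)"
  proof (rule exp_drift[where Z = "\<lambda>_. 0" and X = "V \<xi> \<Delta> \<alpha> n" and Y = "V \<xi> \<Delta> \<alpha> (Suc n)",
        OF subalgebra_hist _ measurable_V measurable_V_M
        integrable_exp_V[OF assms] integrable_exp_V[OF assms] _ _ _ _ assms(1)])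
    show "space M \<in> sets (hist M \<xi> n)" by (metis sets.top space_hist)
    show "AE \<omega> in M. \<omega> \<in> space M \<longrightarrow> V \<xi> \<Delta> \<alpha> (Suc n) \<omega> \<le> V \<xi> \<Delta> \<alpha> n \<omega> + (1 + \<alpha>) - 0"
      using AE_regular
    proof eventually_elim
      case (elim \<omega>)
      show ?case using V_Suc_le[OF elim assms(2), of n] by linarith
    qed
    have "AE \<omega> in M. real_cond_exp M (hist M \<xi> n) (\<lambda>_. 0) \<omega> = (0::real)"
      by (intro real_cond_exp_F_meas) auto
    then show "AE \<omega> in M. \<omega> \<in> space M \<longrightarrow> 0 * 1 \<le> real_cond_exp M (hist M \<xi> n) (\<lambda>_. 0) \<omega>"
      by eventually_elim simp
  qed auto
  then show ?thesis using AE_space by eventually_elim simp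
qed

text \<open>If the next gap exceeds \<open>\<Delta>\<close>, the window contains only the new block, so \<open>L\<close> drops from at least
  \<open>l0\<close> to \<open>1\<close>.\<close>

lemma drift_many_recent:
  fixes l0 :: real
  assumes "0 < \<eta>" "0 < \<alpha>" "0 < l0"
  shows "AE \<omega> in M. l0 \<le> L \<xi> \<Delta> n \<omega> \<longrightarrow>
    real_cond_exp M (hist M \<xi> n) (\<lambda>\<omega>. exp (\<eta> * V \<xi> \<Delta> \<alpha> (Suc n) \<omega>)) \<omega>
     \<le> exp (\<eta> * (1 + \<alpha>)) * (1 - exp (- rate * \<Delta>) * (1 - exp (- \<eta> * (\<alpha> * l0)))) * exp (\<eta> * V \<xi> \<Delta> \<alpha> n \<omega>)"
proof -
  interpret sigma_finite_subalgebra M "hist M \<xi> n" by (rule sigma_finite_subalgebraI[OF subalgebra_hist])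
  let ?gap = "\<lambda>\<omega>. \<Delta> < issue_time \<xi> (Suc n) \<omega> - issue_time \<xi> n \<omega>"
  let ?A = "{\<omega> \<in> space (hist M \<xi> n). l0 \<le> real (L \<xi> \<Delta> n \<omega>)}"
  let ?Z = "\<lambda>\<omega>. \<alpha> * l0 * indicat_real {\<omega> \<in> space M. ?gap \<omega>} \<omega>"
  have gap: "{\<omega> \<in> space M. ?gap \<omega>} \<in> events" using measurable_gap[of n] by measurable
  have b: "0 < \<alpha> * l0" using assms by simp
  have "AE \<omega> in M. \<omega> \<in> ?A \<longrightarrow>
    real_cond_exp M (hist M \<xi> n) (\<lambda>\<omega>. exp (\<eta> * V \<xi> \<Delta> \<alpha> (Suc n) \<omega>)) \<omega>
     \<le> exp (\<eta> * (1 + \<alpha>)) * (1 - exp (- rate * \<Delta>) * (1 - exp (- \<eta> * (\<alpha> * l0)))) * exp (\<eta> * V \<xi> \<Delta> \<alpha> n \<omega>)"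
  proof (rule exp_drift[where Z = ?Z and X = "V \<xi> \<Delta> \<alpha> n" and Y = "V \<xi> \<Delta> \<alpha> (Suc n)",
        OF subalgebra_hist _ measurable_V measurable_V_M
        integrable_exp_V[OF assms(1,2)] integrable_exp_V[OF assms(1,2)] _ _ _ b assms(1)])
    show "?A \<in> sets (hist M \<xi> n)"
      using measurable_L[OF past_hist, of \<Delta> n] by measurable
    show "?Z \<in> borel_measurable M" using gap by simp
    show "0 \<le> ?Z \<omega>" "?Z \<omega> \<le> \<alpha> * l0" for \<omega> using b by (auto simp: indicator_def)
    show "AE \<omega> in M. \<omega> \<in> ?A \<longrightarrow> V \<xi> \<Delta> \<alpha> (Suc n) \<omega> \<le> V \<xi> \<Delta> \<alpha> n \<omega> + (1 + \<alpha>) - ?Z \<omega>"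
      using AE_regular
    proof (eventually_elim, intro impI)
      fix \<omega> assume reg: "regular \<omega>" and A: "\<omega> \<in> ?A"
      show "V \<xi> \<Delta> \<alpha> (Suc n) \<omega> \<le> V \<xi> \<Delta> \<alpha> n \<omega> + (1 + \<alpha>) - ?Z \<omega>"
      proof (cases "?gap \<omega>")
        case True
        then have "L \<xi> \<Delta> (Suc n) \<omega> \<le> 1" using L_Suc_le(2)[OF reg, of n] by simp
        then have "real (L \<xi> \<Delta> (Suc n) \<omega>) \<le> real (L \<xi> \<Delta> n \<omega>) + 1 - l0" using A by auto
        then have "\<alpha> * real (L \<xi> \<Delta> (Suc n) \<omega>) \<le> \<alpha> * (real (L \<xi> \<Delta> n \<omega>) + 1 - l0)"
          using assms(2) by (intro mult_left_mono) auto
        moreover have "real (X_obs \<xi> (Suc n) \<omega>) \<le> real (X_obs \<xi> n \<omega>) + 1"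
          using X_obs_Suc_le[of n \<omega>] by linarith
        ultimately show ?thesis using True A by (simp add: V_def algebra_simps)
      next
        case False
        then show ?thesis using V_Suc_le[OF reg assms(2), of n] by (simp add: indicator_def)
      qed
    qed
    have "AE \<omega> in M. real_cond_exp M (hist M \<xi> n) ?Z \<omega> = \<alpha> * l0 * cprob M (hist M \<xi> n) ?gap \<omega>"
      unfolding cprob_def by (intro real_cond_exp_cmult integrable_indicat gap)
    then show "AE \<omega> in M. \<omega> \<in> ?A \<longrightarrow> exp (- rate * \<Delta>) * (\<alpha> * l0) \<le> real_cond_exp M (hist M \<xi> n) ?Z \<omega>"
      using cprob_gap_ge[of n]
    proof eventually_elim
      case (elim \<omega>)
      then show ?case using b mult_left_mono[of "exp (- rate * \<Delta>)" "cprob M (hist M \<xi> n) ?gap \<omega>" "\<alpha> * l0"]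
        by (simp add: mult.commute)
    qed
  qed
  then show ?thesis using AE_space by eventually_elim simp
qed

text \<open>The decrease is the number of the first two references that hit observer tips. They are distinct,
  so the new block covers at least that many tips.\<close>

lemma drift_few_recent:
  fixes p l0 :: real
  assumes "0 < \<eta>" "0 < \<alpha>"
    and frac: "\<And>\<omega> i. regular \<omega> \<Longrightarrow> L \<xi> \<Delta> n \<omega> < l0 \<Longrightarrow> K < V \<xi> \<Delta> \<alpha> n \<omega> \<Longrightarrow>
      2 \<le> card (pool_pre \<xi> (Suc n) i \<omega>) \<and>
      p * card (pool_pre \<xi> (Suc n) i \<omega>) \<le> card (pool_pre \<xi> (Suc n) i \<omega> \<inter> pool_obs \<xi> n \<omega>)"
  shows "AE \<omega> in M. L \<xi> \<Delta> n \<omega> < l0 \<longrightarrow> K < V \<xi> \<Delta> \<alpha> n \<omega> \<longrightarrow>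
    real_cond_exp M (hist M \<xi> n) (\<lambda>\<omega>. exp (\<eta> * V \<xi> \<Delta> \<alpha> (Suc n) \<omega>)) \<omega>
     \<le> exp (\<eta> * (1 + \<alpha>)) * (1 - p * (1 - exp (- \<eta> * 2))) * exp (\<eta> * V \<xi> \<Delta> \<alpha> n \<omega>)"
proof -
  interpret sigma_finite_subalgebra M "hist M \<xi> n" by (rule sigma_finite_subalgebraI[OF subalgebra_hist])
  let ?H = "\<lambda>j \<omega>. j < length (Ref \<xi> (Suc n) \<omega>) \<and> Ref \<xi> (Suc n) \<omega> ! j \<in> pool_obs \<xi> n \<omega>"
  let ?A = "{\<omega> \<in> space (hist M \<xi> n). real (L \<xi> \<Delta> n \<omega>) < l0 \<and> K < V \<xi> \<Delta> \<alpha> n \<omega>}"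
  let ?Z = "\<lambda>\<omega>. indicat_real {\<omega> \<in> space M. ?H 0 \<omega>} \<omega> + indicat_real {\<omega> \<in> space M. ?H 1 \<omega>} \<omega>"
  have H: "{\<omega> \<in> space M. ?H j \<omega>} \<in> events" for j using pred_Ref_nth_in_obs[of j n] unfolding pred_def .
  have A: "?A \<in> sets (hist M \<xi> n)"
    using measurable_L[OF past_hist, of \<Delta> n] measurable_V[of \<alpha> n] by measurable
  have "AE \<omega> in M. \<omega> \<in> ?A \<longrightarrow>
    real_cond_exp M (hist M \<xi> n) (\<lambda>\<omega>. exp (\<eta> * V \<xi> \<Delta> \<alpha> (Suc n) \<omega>)) \<omega>
     \<le> exp (\<eta> * (1 + \<alpha>)) * (1 - p * (1 - exp (- \<eta> * 2))) * exp (\<eta> * V \<xi> \<Delta> \<alpha> n \<omega>)"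
  proof (rule exp_drift[where Z = ?Z and X = "V \<xi> \<Delta> \<alpha> n" and Y = "V \<xi> \<Delta> \<alpha> (Suc n)",
        OF subalgebra_hist A measurable_V measurable_V_M
        integrable_exp_V[OF assms(1,2)] integrable_exp_V[OF assms(1,2)] _ _ _ _ assms(1)])
    show "?Z \<in> borel_measurable M" using H by (intro borel_measurable_add borel_measurable_indicator)
    show "0 \<le> ?Z \<omega>" "?Z \<omega> \<le> 2" for \<omega> by (auto simp: indicator_def)
    show "AE \<omega> in M. \<omega> \<in> ?A \<longrightarrow> V \<xi> \<Delta> \<alpha> (Suc n) \<omega> \<le> V \<xi> \<Delta> \<alpha> n \<omega> + (1 + \<alpha>) - ?Z \<omega>"
      using AE_regular
    proof (eventually_elim, intro impI)
      fix \<omega> assume reg: "regular \<omega>"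
      let ?R = "Ref \<xi> (Suc n) \<omega>"
      have dist: "distinct ?R" using reg by (simp add: regular_def)
      \<comment> \<open>The positions among the first two whose reference is an observer tip.\<close>
      define J where "J = (if ?H 0 \<omega> then {0::nat} else {}) \<union> (if ?H 1 \<omega> then {1} else {})"
      have "card J = card ((!) ?R ` J)"
        using dist by (intro card_image[symmetric] inj_onI) (auto simp: J_def nth_eq_iff_index_eq split: if_splits)
      also have "\<dots> \<le> card (pool_obs \<xi> n \<omega> \<inter> set ?R)"
        by (intro card_mono) (auto simp: J_def split: if_splits)
      finally have "card J \<le> card (pool_obs \<xi> n \<omega> \<inter> set ?R)" .
      moreover have "?Z \<omega> \<le> card J"
        by (simp add: J_def indicator_def)
      ultimately have "?Z \<omega> \<le> card (pool_obs \<xi> n \<omega> \<inter> set ?R)" by linarith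
      then show "V \<xi> \<Delta> \<alpha> (Suc n) \<omega> \<le> V \<xi> \<Delta> \<alpha> n \<omega> + (1 + \<alpha>) - ?Z \<omega>"
        using V_Suc_le[OF reg assms(2), of n] by linarith
    qed
    have fr: "AE \<omega> in M. \<omega> \<in> ?A \<longrightarrow> (\<forall>i. 2 \<le> card (pool_pre \<xi> (Suc n) i \<omega>) \<and>
      p * card (pool_pre \<xi> (Suc n) i \<omega>) \<le> card (pool_pre \<xi> (Suc n) i \<omega> \<inter> pool_obs \<xi> n \<omega>))"
      using AE_regular by eventually_elim (use frac in auto)
    have ge: "AE \<omega> in M. \<omega> \<in> ?A \<longrightarrow> p \<le> cprob M (hist M \<xi> n) (?H j) \<omega>" if "j < 2" for j
      by (rule cprob_Ref_nth_in_obs_ge[OF A that fr])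
    have "AE \<omega> in M. real_cond_exp M (hist M \<xi> n) ?Z \<omega> = cprob M (hist M \<xi> n) (?H 0) \<omega> + cprob M (hist M \<xi> n) (?H 1) \<omega>"
      unfolding cprob_def by (intro real_cond_exp_add integrable_indicat H)
    then show "AE \<omega> in M. \<omega> \<in> ?A \<longrightarrow> p * 2 \<le> real_cond_exp M (hist M \<xi> n) ?Z \<omega>"
      using ge[of 0, simplified] ge[of 1, simplified]
      by eventually_elim auto
  qed simp
  then show ?thesis using AE_space by eventually_elim simp
qed

end

text \<open>From \<open>\<gamma>(\<beta>)\<^sup>2 > 3/4\<close> one has \<open>\<gamma>(\<beta>) > 4/5\<close>, which is linear in \<open>\<beta>\<close> after clearing the denominator.\<close>

lemma gamma_fun_gt_imp:
  assumes adm: "0 < \<beta>" "\<beta> < 1 / (real k + 1)" "(gamma_fun k \<beta>)\<^sup>2 > 3 / 4"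
  shows "9 * (real k * \<beta>) + 5 * \<beta> < 1"
proof -
  have pos: "0 < 1 - (real k + 1) * \<beta>"
    using assms(2) by (simp add: field_simps)
  have den: "0 < 1 + real k * \<beta>" using assms(1) by (simp add: add_pos_nonneg)
  have "0 < gamma_fun k \<beta>" using pos den by (simp add: gamma_fun_def)
  moreover have "\<not> gamma_fun k \<beta> \<le> 4 / 5"
  proof
    assume "gamma_fun k \<beta> \<le> 4 / 5"
    then have "(gamma_fun k \<beta>)\<^sup>2 \<le> (4 / 5)\<^sup>2"
      using \<open>0 < gamma_fun k \<beta>\<close> by (intro power_mono) auto
    then show False using assms(3) by (simp add: power2_eq_square)
  qed
  ultimately have "4 / 5 * (1 + real k * \<beta>) < 1 - (real k + 1) * \<beta>"
    using den by (simp add: gamma_fun_def pos_less_divide_eq not_le)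
  then have "4 / 5 * (1 + t) < 1 - (t + \<beta>)" if "t = real k * \<beta>" for t
    using that by (simp add: distrib_right)
  from this[OF refl] show ?thesis
    by (simp only: distrib_left)
qed

text \<open>In the application \<open>x\<close> and \<open>l\<close> are the observer tip count and \<open>L\<close>, \<open>s\<close> is the size of the issuer's
  pool and \<open>u\<close> the number of observer tips in it. As \<open>V > K\<close> and \<open>l < \<ell>\<^sub>0\<close>, the part \<open>x\<close> must be at least
  \<open>max K\<^sub>0 (\<ell>\<^sub>0 / \<beta>)\<close>, so \<open>l \<le> \<beta> x\<close>.\<close>

lemma tip_fraction:
  fixes x l u s :: real
  assumes adm: "admissible_constants rate \<Delta> k \<beta> K\<^sub>0 \<alpha> K"
    and l: "0 \<le> l" "l < ell_0 rate \<Delta> \<alpha>" and V: "K < x + \<alpha> * l"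
    and xu: "x \<le> u + l" and us: "u \<le> s" and su: "s \<le> u + real k * l"
  shows "2 \<le> s" "4 / 5 * s \<le> u"
proof -
  let ?l0 = "real_of_int (ell_0 rate \<Delta> \<alpha>)"
  have \<beta>: "0 < \<beta>" "\<beta> < 1 / (real k + 1)" "(gamma_fun k \<beta>)\<^sup>2 > 3 / 4"
    and K0: "\<And>x. x \<ge> K\<^sub>0 \<Longrightarrow> x * (1 - (real k + 1) * \<beta>) \<ge> 2"
    and \<alpha>: "0 < \<alpha>" and K: "K = max K\<^sub>0 (?l0 / \<beta>) + \<alpha> * ?l0 + 1"
    using adm by (auto simp: admissible_constants_def)
  have "\<alpha> * l \<le> \<alpha> * ?l0" using l(2) \<alpha> by (intro mult_left_mono) auto
  then have x: "x \<ge> K\<^sub>0" "x \<ge> ?l0 / \<beta>" using V K by linarith+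
  have lx: "l \<le> \<beta> * x" using x(2) l(2) \<beta>(1) by (simp add: field_simps)
  have x0: "0 \<le> x" using lx l(1) \<beta>(1) by (smt (verit) mult_pos_neg)
  have klx: "real k * l \<le> real k * (\<beta> * x)" using lx by (intro mult_left_mono) auto
  have kx: "0 \<le> real k * (\<beta> * x)" using x0 \<beta>(1) by simp
  have "2 \<le> x * (1 - (real k + 1) * \<beta>)" by (rule K0[OF x(1)])
  also have "\<dots> = x - real k * (\<beta> * x) - \<beta> * x" by (simp add: algebra_simps)
  finally show "2 \<le> s" using kx lx xu us by linarith
  \<comment> \<open>\<open>4 k l \<le> u\<close> is what \<open>4/5 (u + k l) \<le> u\<close> amounts to.\<close>
  have "x * (9 * (real k * \<beta>) + 5 * \<beta>) \<le> x * 1"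
    using gamma_fun_gt_imp[OF \<beta>] x0 by (intro mult_left_mono) auto
  then have "9 * (real k * (\<beta> * x)) + 5 * (\<beta> * x) \<le> x" by (simp add: algebra_simps)
  then have "4 * (real k * l) \<le> u" using klx kx lx xu l(1) by linarith
  then show "4 / 5 * s \<le> u" using su by linarith
qed

text \<open>The two mean decreases \<open>q \<alpha> \<ell>\<^sub>0 \<ge> 2 (1 + \<alpha>)\<close> and \<open>8/5\<close> both exceed \<open>1 + \<alpha> \<le> 5/4\<close>.\<close>

lemma exists_drift_rate:
  assumes adm: "admissible_constants rate \<Delta> k \<beta> K\<^sub>0 \<alpha> K"
    and "0 \<le> rate * \<Delta>"
  shows "\<exists>\<eta>>0. exp (\<eta> * (1 + \<alpha>)) * (1 - exp (- rate * \<Delta>) * (1 - exp (- \<eta> * (\<alpha> * ell_0 rate \<Delta> \<alpha>)))) < 1 \<and>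
    exp (\<eta> * (1 + \<alpha>)) * (1 - 4 / 5 * (1 - exp (- \<eta> * 2))) < 1"
proof -
  let ?q = "exp (- rate * \<Delta>)" and ?l0 = "real_of_int (ell_0 rate \<Delta> \<alpha>)"
  have \<alpha>: "0 < \<alpha>" "\<alpha> \<le> 1 / 4" using adm by (auto simp: admissible_constants_def epsilon_X_def)
  have "2 * (1 + \<alpha>) / (\<alpha> * ?q) \<le> ?l0" by (simp add: ell_0_def Let_def)
  then have ql0: "2 * (1 + \<alpha>) \<le> ?q * (\<alpha> * ?l0)" using \<alpha> by (simp add: field_simps)
  then have pos: "0 < ?q * (\<alpha> * ?l0)" using \<alpha> by (intro less_le_trans[OF _ ql0]) auto
  then have "0 < \<alpha> * ?l0" by (simp add: zero_less_mult_iff)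
  then have "eventually (\<lambda>\<eta>. exp (\<eta> * (1 + \<alpha>)) * (1 - ?q * (1 - exp (- \<eta> * (\<alpha> * ?l0)))) < 1) (at_right 0)"
    using ql0 \<alpha> assms(2) by (intro exp_contraction_rate) auto
  moreover have "eventually (\<lambda>\<eta>. exp (\<eta> * (1 + \<alpha>)) * (1 - 4 / 5 * (1 - exp (- \<eta> * 2))) < 1) (at_right (0::real))"
    using \<alpha> by (intro exp_contraction_rate) auto
  moreover have "eventually (\<lambda>\<eta>::real. 0 < \<eta>) (at_right 0)" by (rule eventually_at_right_less)
  ultimately have "eventually (\<lambda>\<eta>. 0 < \<eta> \<and> exp (\<eta> * (1 + \<alpha>)) * (1 - ?q * (1 - exp (- \<eta> * (\<alpha> * ?l0)))) < 1 \<and>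
     exp (\<eta> * (1 + \<alpha>)) * (1 - 4 / 5 * (1 - exp (- \<eta> * 2))) < 1) (at_right 0)"
    by eventually_elim auto
  then show ?thesis
    using eventually_happens[of _ "at_right (0::real)"] by (auto simp: trivial_limit_at_right_real)
qed

section \<open>Exponential tail bounds\<close>

lemma hit_time_gt_iff: "enat n < hit_time \<xi> \<Delta> \<alpha> K m \<omega> \<longleftrightarrow> (\<forall>j\<le>n. K < V \<xi> \<Delta> \<alpha> (m + j) \<omega>)"
proof
  assume gt: "enat n < hit_time \<xi> \<Delta> \<alpha> K m \<omega>"
  show "\<forall>j\<le>n. K < V \<xi> \<Delta> \<alpha> (m + j) \<omega>"
  proof (intro allI impI, rule ccontr)
    fix j assume "j \<le> n" "\<not> K < V \<xi> \<Delta> \<alpha> (m + j) \<omega>"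
    then have "hit_time \<xi> \<Delta> \<alpha> K m \<omega> \<le> enat j"
      unfolding hit_time_def by (intro INF_lower) auto
    also have "\<dots> \<le> enat n" using \<open>j \<le> n\<close> by simp
    finally show False using gt by simp
  qed
next
  assume all: "\<forall>j\<le>n. K < V \<xi> \<Delta> \<alpha> (m + j) \<omega>"
  have "enat (Suc n) \<le> hit_time \<xi> \<Delta> \<alpha> K m \<omega>"
    unfolding hit_time_def
  proof (rule INF_greatest)
    fix j assume "j \<in> {j. V \<xi> \<Delta> \<alpha> (m + j) \<omega> \<le> K}"
    then have "\<not> j \<le> n" using all by fastforce
    then show "enat (Suc n) \<le> enat j" by simp
  qed
  moreover have "enat n < enat (Suc n)" by simp
  ultimately show "enat n < hit_time \<xi> \<Delta> \<alpha> K m \<omega>" by (rule less_le_trans[rotated])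
qed

theorem theorem3p6:
  fixes M :: "'w measure" and rate \<Delta> \<beta> K\<^sub>0 \<alpha> K :: real and k :: nat
    and \<nu> :: "'v::finite pmf" and D :: "'v \<Rightarrow> ('v \<Rightarrow> real) measure"
    and \<xi> :: "('w, 'v) blocks"
  assumes "block_model M rate \<Delta> k \<nu> D \<xi>"
    and "admissible_constants rate \<Delta> k \<beta> K\<^sub>0 \<alpha> K"
  shows "\<exists>\<eta>>0. \<exists>\<rho>. 0 < \<rho> \<and> \<rho> < 1 \<and>
    (\<forall>m n. AE \<omega> in M.
       real_cond_exp M (hist M \<xi> m) (\<lambda>\<omega>. exp (\<eta> * V \<xi> \<Delta> \<alpha> (m + n) \<omega>)) \<omega>
         \<le> \<rho> ^ n * exp (\<eta> * V \<xi> \<Delta> \<alpha> m \<omega>)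
           + (1 - \<rho> ^ n) / (1 - \<rho>) * exp (\<eta> * (1 + \<alpha>)) * exp (\<eta> * K)) \<and>
    (\<forall>m n. \<forall>x::real. AE \<omega> in M.
       cprob M (hist M \<xi> m) (\<lambda>\<omega>. V \<xi> \<Delta> \<alpha> (m + n) \<omega> \<ge> x) \<omega>
         \<le> \<rho> ^ n * exp (\<eta> * (V \<xi> \<Delta> \<alpha> m \<omega> - x))
           + (1 - \<rho> ^ n) / (1 - \<rho>) * exp (\<eta> * (1 + \<alpha>)) * exp (\<eta> * (K - x))) \<and>
    (\<forall>m n. AE \<omega> in M.
       cprob M (hist M \<xi> m) (\<lambda>\<omega>. hit_time \<xi> \<Delta> \<alpha> K m \<omega> > enat n) \<omega>
         \<le> exp (\<eta> * (V \<xi> \<Delta> \<alpha> m \<omega> - K)) * \<rho> ^ n) \<and>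
    (\<forall>n. \<forall>\<omega>\<in>space M. real (X_obs \<xi> n \<omega>) \<le> V \<xi> \<Delta> \<alpha> n \<omega>) \<and>
    (\<forall>i n. AE \<omega> in M. real (X_loc \<xi> i n \<omega>) \<le> (1 + real k / \<alpha>) * V \<xi> \<Delta> \<alpha> n \<omega>) \<and>
    (\<forall>m n. \<forall>x::real. AE \<omega> in M.
       cprob M (hist M \<xi> m) (\<lambda>\<omega>. real (X_obs \<xi> (m + n) \<omega>) \<ge> x) \<omega>
         \<le> \<rho> ^ n * exp (\<eta> * (V \<xi> \<Delta> \<alpha> m \<omega> - x))
           + (1 - \<rho> ^ n) / (1 - \<rho>) * exp (\<eta> * (1 + \<alpha>)) * exp (\<eta> * (K - x))) \<and>
    (\<forall>i m n. \<forall>x::real. AE \<omega> in M.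
       cprob M (hist M \<xi> m) (\<lambda>\<omega>. real (X_loc \<xi> i (m + n) \<omega>) \<ge> (1 + real k / \<alpha>) * x) \<omega>
         \<le> \<rho> ^ n * exp (\<eta> * (V \<xi> \<Delta> \<alpha> m \<omega> - x))
           + (1 - \<rho> ^ n) / (1 - \<rho>) * exp (\<eta> * (1 + \<alpha>)) * exp (\<eta> * (K - x)))"
proof -
  interpret block_model M rate \<Delta> k \<nu> D \<xi> by (rule assms(1))
  note adm = assms(2)
  let ?l0 = "real_of_int (ell_0 rate \<Delta> \<alpha>)"
  have \<alpha>: "0 < \<alpha>" using adm by (simp add: admissible_constants_def)
  have "0 < 2 * (1 + \<alpha>) / (\<alpha> * exp (- rate * \<Delta>))" using \<alpha> by simp
  also have "\<dots> \<le> ?l0" by (simp add: ell_0_def Let_def)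
  finally have l0: "0 < ?l0" .
  have "0 \<le> rate * \<Delta>" using rate_pos Delta_nonneg by simp
  from exists_drift_rate[OF adm this] obtain \<eta> where \<eta>: "0 < \<eta>"
    and f1: "exp (\<eta> * (1 + \<alpha>)) * (1 - exp (- rate * \<Delta>) * (1 - exp (- \<eta> * (\<alpha> * ?l0)))) < 1"
    and f2: "exp (\<eta> * (1 + \<alpha>)) * (1 - 4 / 5 * (1 - exp (- \<eta> * 2))) < 1"
    by blast
  define \<rho> where "\<rho> = max (exp (\<eta> * (1 + \<alpha>)) * (1 - exp (- rate * \<Delta>) * (1 - exp (- \<eta> * (\<alpha> * ?l0)))))
    (exp (\<eta> * (1 + \<alpha>)) * (1 - 4 / 5 * (1 - exp (- \<eta> * 2))))"
  have "0 < 1 - 4 / 5 * (1 - e)" if "0 < e" for e :: real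
    using that by (simp add: field_simps)
  from this[of "exp (- \<eta> * 2)"] have \<rho>: "0 < \<rho>" "\<rho> < 1" using f1 f2 by (auto simp: \<rho>_def less_max_iff_disj)
  let ?W = "\<lambda>n \<omega>. exp (\<eta> * V \<xi> \<Delta> \<alpha> n \<omega>)"
  let ?C = "exp (\<eta> * (1 + \<alpha>)) * exp (\<eta> * K)"

  have frac: "2 \<le> card (pool_pre \<xi> (Suc n) i \<omega>) \<and>
      4 / 5 * card (pool_pre \<xi> (Suc n) i \<omega>) \<le> card (pool_pre \<xi> (Suc n) i \<omega> \<inter> pool_obs \<xi> n \<omega>)"
    if "regular \<omega>" "L \<xi> \<Delta> n \<omega> < ?l0" "K < V \<xi> \<Delta> \<alpha> n \<omega>" for n i \<omega>
  proof -
    note est = pool_pre_estimates[OF that(1), of n i, folded of_nat_le_iff[where 'a = real], unfolded of_nat_add of_nat_mult]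
    have "card (pool_pre \<xi> (Suc n) i \<omega> \<inter> pool_obs \<xi> n \<omega>) \<le> card (pool_pre \<xi> (Suc n) i \<omega>)"
      by (intro card_mono finite_pool_pre) auto
    then show ?thesis
      using tip_fraction[OF adm _ that(2) that(3)[unfolded V_def] est(1) _ est(2)] by simp
  qed
  have few: "AE \<omega> in M. L \<xi> \<Delta> n \<omega> < ?l0 \<longrightarrow> K < V \<xi> \<Delta> \<alpha> n \<omega> \<longrightarrow> real_cond_exp M (hist M \<xi> n) (?W (Suc n)) \<omega>
      \<le> exp (\<eta> * (1 + \<alpha>)) * (1 - 4 / 5 * (1 - exp (- \<eta> * 2))) * ?W n \<omega>" for n
    by (rule drift_few_recent[OF \<eta> \<alpha> frac])
  have drift: "AE \<omega> in M. exp (\<eta> * K) < ?W n \<omega> \<longrightarrow> real_cond_exp M (hist M \<xi> n) (?W (Suc n)) \<omega> \<le> \<rho> * ?W n \<omega>" for n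
    using drift_many_recent[OF \<eta> \<alpha> l0, of n] few[of n]
  proof eventually_elim
    case (elim \<omega>)
    have max1: "exp (\<eta> * (1 + \<alpha>)) * (1 - exp (- rate * \<Delta>) * (1 - exp (- \<eta> * (\<alpha> * ?l0)))) * ?W n \<omega> \<le> \<rho> * ?W n \<omega>"
      unfolding \<rho>_def by (intro mult_right_mono) auto
    have max2: "exp (\<eta> * (1 + \<alpha>)) * (1 - 4 / 5 * (1 - exp (- \<eta> * 2))) * ?W n \<omega> \<le> \<rho> * ?W n \<omega>"
      unfolding \<rho>_def by (intro mult_right_mono) auto
    show ?case
    proof
      assume "exp (\<eta> * K) < ?W n \<omega>"
      then have "K < V \<xi> \<Delta> \<alpha> n \<omega>" using \<eta> by simp
      then show "real_cond_exp M (hist M \<xi> n) (?W (Suc n)) \<omega> \<le> \<rho> * ?W n \<omega>"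
        using order_trans[OF _ max1] order_trans[OF _ max2] elim by (cases "?l0 \<le> L \<xi> \<Delta> n \<omega>") auto
    qed
  qed
  have bounded: "AE \<omega> in M. ?W n \<omega> \<le> exp (\<eta> * K) \<longrightarrow> real_cond_exp M (hist M \<xi> n) (?W (Suc n)) \<omega> \<le> ?C" for n
    using growth_bound[OF \<eta> \<alpha>, of n]
    by eventually_elim (auto intro: order_trans mult_left_mono)
  have W_meas: "?W n \<in> borel_measurable (hist M \<xi> n)" for n
    using measurable_V[of \<alpha> n] by simp
  note gd = subalgebra_hist subalgebra_hist_mono W_meas integrable_exp_V[OF \<eta> \<alpha>] _ \<rho> _ drift bounded
  have moment: "AE \<omega> in M. real_cond_exp M (hist M \<xi> m) (?W (m + n)) \<omega> \<le> \<rho> ^ n * ?W m \<omega> + (1 - \<rho> ^ n) / (1 - \<rho>) * ?C" for m n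
    by (rule geometric_drift_moment[where F = "hist M \<xi>" and W = ?W, OF gd]) auto
  have hitting: "AE \<omega> in M. cprob M (hist M \<xi> m) (\<lambda>\<omega>. \<forall>j\<le>n. exp (\<eta> * K) < ?W (m + j) \<omega>) \<omega>
      \<le> ?W m \<omega> / exp (\<eta> * K) * \<rho> ^ n" for m n
    by (rule geometric_drift_hitting[where F = "hist M \<xi>" and W = ?W, OF gd]) auto

  have tail: "AE \<omega> in M. cprob M (hist M \<xi> m) P \<omega> \<le> \<rho> ^ n * exp (\<eta> * (V \<xi> \<Delta> \<alpha> m \<omega> - x))
           + (1 - \<rho> ^ n) / (1 - \<rho>) * exp (\<eta> * (1 + \<alpha>)) * exp (\<eta> * (K - x))"
    if P: "Measurable.pred M P" and le: "AE \<omega> in M. P \<omega> \<longrightarrow> x \<le> V \<xi> \<Delta> \<alpha> (m + n) \<omega>" for m n x P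
  proof -
    have "AE \<omega> in M. cprob M (hist M \<xi> m) P \<omega> \<le> (\<rho> ^ n * ?W m \<omega> + (1 - \<rho> ^ n) / (1 - \<rho>) * ?C) / exp (\<eta> * x)"
    proof (rule cond_markov[OF subalgebra_hist integrable_exp_V[OF \<eta> \<alpha>] _ P _ _ moment])
      show "AE \<omega> in M. P \<omega> \<longrightarrow> exp (\<eta> * x) \<le> ?W (m + n) \<omega>"
        using le by eventually_elim (use \<eta> in auto)
    qed auto
    then show ?thesis
      by (simp add: add_divide_distrib exp_diff right_diff_distrib mult.assoc)
  qed

  have loc: "AE \<omega> in M. real (X_loc \<xi> i n \<omega>) \<le> (1 + real k / \<alpha>) * V \<xi> \<Delta> \<alpha> n \<omega>" for i n
    using AE_regular
  proof eventually_elim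
    case (elim \<omega>)
    have "real (X_loc \<xi> i n \<omega>) \<le> real (X_obs \<xi> n \<omega>) + real k * real (L \<xi> \<Delta> n \<omega>)"
      using X_loc_le[OF elim, of i n] by (simp flip: of_nat_mult of_nat_add)
    \<comment> \<open>The two added terms complete the sum to a multiple of \<open>V\<close>.\<close>
    also have "\<dots> \<le> real (X_obs \<xi> n \<omega>) + real k * real (L \<xi> \<Delta> n \<omega>) + (\<alpha> * real (L \<xi> \<Delta> n \<omega>) + real k / \<alpha> * real (X_obs \<xi> n \<omega>))"
      using \<alpha> by simp
    also have "\<dots> = (1 + real k / \<alpha>) * V \<xi> \<Delta> \<alpha> n \<omega>"
      using \<alpha> by (simp add: V_def field_simps)
    finally show ?case .
  qed
  have obs: "real (X_obs \<xi> n \<omega>) \<le> V \<xi> \<Delta> \<alpha> n \<omega>" for n \<omega>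
    using \<alpha> by (simp add: V_def)
  have kpos: "0 < 1 + real k / \<alpha>" using \<alpha> by (simp add: add_pos_nonneg)

  show ?thesis
  proof (rule exI[of _ \<eta>], intro exI[of _ \<rho>] conjI allI ballI)
    fix m n :: nat and x :: real and i :: 'v
    show "AE \<omega> in M. real_cond_exp M (hist M \<xi> m) (\<lambda>\<omega>. exp (\<eta> * V \<xi> \<Delta> \<alpha> (m + n) \<omega>)) \<omega>
         \<le> \<rho> ^ n * exp (\<eta> * V \<xi> \<Delta> \<alpha> m \<omega>)
           + (1 - \<rho> ^ n) / (1 - \<rho>) * exp (\<eta> * (1 + \<alpha>)) * exp (\<eta> * K)"
      using moment[of m n] by (simp add: mult.assoc)
    show "AE \<omega> in M. cprob M (hist M \<xi> m) (\<lambda>\<omega>. V \<xi> \<Delta> \<alpha> (m + n) \<omega> \<ge> x) \<omega>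
         \<le> \<rho> ^ n * exp (\<eta> * (V \<xi> \<Delta> \<alpha> m \<omega> - x))
           + (1 - \<rho> ^ n) / (1 - \<rho>) * exp (\<eta> * (1 + \<alpha>)) * exp (\<eta> * (K - x))"
      by (rule tail) auto
    show "AE \<omega> in M. cprob M (hist M \<xi> m) (\<lambda>\<omega>. hit_time \<xi> \<Delta> \<alpha> K m \<omega> > enat n) \<omega>
         \<le> exp (\<eta> * (V \<xi> \<Delta> \<alpha> m \<omega> - K)) * \<rho> ^ n"
      using hitting[of m n] \<eta> by (simp add: hit_time_gt_iff exp_diff right_diff_distrib)
    show "AE \<omega> in M. cprob M (hist M \<xi> m) (\<lambda>\<omega>. real (X_obs \<xi> (m + n) \<omega>) \<ge> x) \<omega>
         \<le> \<rho> ^ n * exp (\<eta> * (V \<xi> \<Delta> \<alpha> m \<omega> - x))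
           + (1 - \<rho> ^ n) / (1 - \<rho>) * exp (\<eta> * (1 + \<alpha>)) * exp (\<eta> * (K - x))"
    proof (rule tail)
      show "Measurable.pred M (\<lambda>\<omega>. real (X_obs \<xi> (m + n) \<omega>) \<ge> x)"
        using measurable_X_obs[OF measurable_past, of "m + n"] by measurable
      show "AE \<omega> in M. x \<le> real (X_obs \<xi> (m + n) \<omega>) \<longrightarrow> x \<le> V \<xi> \<Delta> \<alpha> (m + n) \<omega>"
        using obs order_trans by blast
    qed
    show "AE \<omega> in M. cprob M (hist M \<xi> m) (\<lambda>\<omega>. real (X_loc \<xi> i (m + n) \<omega>) \<ge> (1 + real k / \<alpha>) * x) \<omega>
         \<le> \<rho> ^ n * exp (\<eta> * (V \<xi> \<Delta> \<alpha> m \<omega> - x))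
           + (1 - \<rho> ^ n) / (1 - \<rho>) * exp (\<eta> * (1 + \<alpha>)) * exp (\<eta> * (K - x))"
    proof (rule tail)
      show "Measurable.pred M (\<lambda>\<omega>. real (X_loc \<xi> i (m + n) \<omega>) \<ge> (1 + real k / \<alpha>) * x)"
        using measurable_X_loc[of i "m + n"] by measurable
      show "AE \<omega> in M. (1 + real k / \<alpha>) * x \<le> real (X_loc \<xi> i (m + n) \<omega>) \<longrightarrow> x \<le> V \<xi> \<Delta> \<alpha> (m + n) \<omega>"
        using loc[of i "m + n"]
      proof (eventually_elim, intro impI)
        fix \<omega> assume "real (X_loc \<xi> i (m + n) \<omega>) \<le> (1 + real k / \<alpha>) * V \<xi> \<Delta> \<alpha> (m + n) \<omega>"
          "(1 + real k / \<alpha>) * x \<le> real (X_loc \<xi> i (m + n) \<omega>)"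
        then have "(1 + real k / \<alpha>) * x \<le> (1 + real k / \<alpha>) * V \<xi> \<Delta> \<alpha> (m + n) \<omega>" by linarith
        then show "x \<le> V \<xi> \<Delta> \<alpha> (m + n) \<omega>" using kpos by (simp only: mult_le_cancel_left_pos)
      qed
    qed
  qed (use \<eta> \<rho> obs loc in auto)
qed

end
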